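(* Let $A=(a_{nk})_{n,k\in\mathbb N_0}$ be an infinite real matrix, let $1\le p\le\infty$, and let $q$ be the conjugate exponent of $p$. Put $$\widehat a_{nk}=\lambda_k\left\{\frac{f_{k+1}^2a_{nk}}{(\lambda_k-\lambda_{k-1})f_kf_{k+1}}+\left[\frac1{(\lambda_k-\lambda_{k-1})f_kf_{k+1}}-\frac1{(\lambda_{k+1}-\lambda_k)f_{k+1}f_{k+2}}\right]\sum_{j=k+1}^\infty f_{j+1}^2a_{nj}\right\}.$$ (a) Let $Y\in\{c_0,c,\ell_\infty\}$. If $A\in(\ell_p^{\lambda}(\widehat F):Y)$, then the operator $L_A:\ell_p^{\lambda}(\widehat F)\to Y$, $L_Ax=Ax$, satisfies $\|L_A\|=\|A\|_{(\ell_p^{\lambda}(\widehat F):\ell_\infty)}$, where $$\|A\|_{(\ell_p^{\lambda}(\widehat F):\ell_\infty)}=\begin{cases}\sup_{n}\sum_k|\widehat a_{nk}|,&p=\infty,\\ \sup_{n}\big(\sum_k|\widehat a_{nk}|^q\big)^{1/q},&1<p<\infty,\\ \sup_{k,n}|\widehat a_{nk}|,&p=1.\end{cases}$$ (b) Let $\mathcal F$ be the collection of finite subsets of $\mathbb N_0$. If $A\in(\ell_p^{\lambda}(\widehat F):\ell_1)$, put $$\|A\|_{(\ell_p^{\lambda}(\widehat F):\ell_1)}=\begin{cases}\sup_{N\in\mathcal F}\sum_k\big|\sum_{n\in N}\widehat a_{nk}\big|,&p=\infty,\\ \sup_{N\in\mathcal F}\big(\sum_k\big|\sum_{n\in N}\widehat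 a_{nk}\big|^q\big)^{1/q},&1<p<\infty,\\ \sup_{k}\sum_{n=0}^\infty|\widehat a_{nk}|,&p=1.\end{cases}$$ Then the operator $L_A:\ell_p^{\lambda}(\widehat F)\to\ell_1$, $L_Ax=Ax$, satisfies $\|L_A\|=\|A\|_{(\ell_p^{\lambda}(\widehat F):\ell_1)}$ if $p=1$, and otherwise $$\|A\|_{(\ell_p^{\lambda}(\widehat F):\ell_1)}\le\|L_A\|\le4\|A\|_{(\ell_p^{\lambda}(\widehat F):\ell_1)}.$$
   Context: $\mathbb N_0=\{0,1,2,\dots\}$; sums without limits run from $0$ to $\infty$; suprema over $n,k$ are over $\mathbb N_0$; $\omega$ is the space of all real sequences $x=(x_k)_{k\in\mathbb N_0}$; $c_0,c,\ell_\infty$ carry the sup norm. Fibonacci numbers: $f_0=f_1=1$, $f_n=f_{n-1}+f_{n-2}$ for $n\ge 2$. $\lambda=(\lambda_k)_{k\in\mathbb N_0}$ is a fixed strictly increasing sequence of positive reals with $\lambda_k\to\infty$. Terms with negative subscript are $0$ (so $\lambda_{-1}=0$, $x_{-1}=0$). For $x\in\omega$ put $$E_n(x)=\frac1{\lambda_n}\sum_{k=0}^n(\lambda_k-\lambda_{k-1})\Big(\frac{f_k}{f_{k+1}}x_k-\frac{f_{k+1}}{f_k}x_{k-1}\Big),\qquad Ex=(E_n(x))_{n\in\mathbb N_0},$$ and $\ell_p^{\lambda}(\widehat F)=\{x\in\omega: Ex\in\ell_p\}$ with norm $\|x\|=\|Ex\|_p$, $1\le p\le\infty$. For sequence spaces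 $X,Y$, $A\in(X:Y)$ means that for every $x\in X$ the series $A_n(x)=\sum_ka_{nk}x_k$ converges for every $n$ and $Ax=(A_n(x))_n\in Y$. $\|L_A\|$ is the operator norm. The series defining $\widehat a_{nk}$ converge whenever $A$ belongs to one of the classes considered. *)

theory Defs
  imports "HOL-Analysis.Analysis" "HOL-Number_Theory.Fib"
begin

text \<open>The convention here is \<open>f\<^sub>0 = f\<^sub>1 = 1\<close>, whereas the library has \<open>fib 0 = 0\<close>.\<close>

definition fibo :: "nat \<Rightarrow> real" where
  "fibo k = real (fib (Suc k))"

text \<open>\<open>prev x k\<close> is \<open>x\<^sub>k\<^sub>-\<^sub>1\<close>, with terms of negative subscript equal to 0.\<close>

definition prev :: "(nat \<Rightarrow> real) \<Rightarrow> nat \<Rightarrow> real" where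
  "prev x k = (case k of 0 \<Rightarrow> 0 | Suc j \<Rightarrow> x j)"

text \<open>Norms, suprema and sums of nonnegative terms take values in \<^typ>\<open>ennreal\<close>, so that
  divergence means the value \<open>\<infinity>\<close>.\<close>

definition ennpowr :: "ennreal \<Rightarrow> real \<Rightarrow> ennreal" where
  "ennpowr t r = (if t = \<infinity> then \<infinity> else ennreal (enn2real t powr r))"

definition lp_norm :: "ennreal \<Rightarrow> (nat \<Rightarrow> real) \<Rightarrow> ennreal" where
  "lp_norm p x =
     (if p = \<infinity> then (SUP k. ennreal \<bar>x k\<bar>)
      else ennpowr (\<Sum>k. ennreal (\<bar>x k\<bar> powr enn2real p)) (1 / enn2real p))"

definition lp :: "ennreal \<Rightarrow> (nat \<Rightarrow> real) set" where
  "lp p = {x. lp_norm p x < \<infinity>}"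

definition c_null :: "(nat \<Rightarrow> real) set" where
  "c_null = {x. x \<longlonglongrightarrow> 0}"

definition c_conv :: "(nat \<Rightarrow> real) set" where
  "c_conv = {x. convergent x}"

lemma lp_finite_iff:
  assumes "p \<noteq> \<infinity>"
  shows "x \<in> lp p \<longleftrightarrow> summable (\<lambda>k. \<bar>x k\<bar> powr enn2real p)"
    (is "_ \<longleftrightarrow> summable ?g")
proof -
  have "x \<in> lp p \<longleftrightarrow> (\<Sum>k. ennreal (?g k)) \<noteq> top"
    using assms by (simp add: lp_def lp_norm_def ennpowr_def)
  also have "\<dots> \<longleftrightarrow> summable ?g"
  proof
    show "summable ?g" if "(\<Sum>k. ennreal (?g k)) \<noteq> top"
      by (rule summable_suminf_not_top[OF powr_ge_zero that])
    show "(\<Sum>k. ennreal (?g k)) \<noteq> top" if "summable ?g"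
      by (rule ennreal_suminf_neq_top[OF that powr_ge_zero])
  qed
  finally show ?thesis .
qed

lemma lp_infinity_iff: "x \<in> lp \<infinity> \<longleftrightarrow> Bseq x"
proof
  assume "x \<in> lp \<infinity>"
  then have "(SUP k. ennreal \<bar>x k\<bar>) < top"
    by (simp add: lp_def lp_norm_def)
  then obtain C where C: "(SUP k. ennreal \<bar>x k\<bar>) = ennreal C" "0 \<le> C"
    by (auto simp: less_top_ennreal)
  have "norm (x k) \<le> C" for k
  proof -
    have "ennreal \<bar>x k\<bar> \<le> ennreal C"
      unfolding C(1)[symmetric] by (rule SUP_upper) simp
    then show ?thesis using C(2) by simp
  qed
  then show "Bseq x" by (rule BseqI')
next
  assume "Bseq x"
  then obtain K where "\<forall>k. norm (x k) \<le> K" by (rule BseqE)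
  then have "(SUP k. ennreal \<bar>x k\<bar>) \<le> ennreal K"
    by (intro SUP_least ennreal_leI) simp
  also have "\<dots> < \<infinity>" by simp
  finally show "x \<in> lp \<infinity>" by (simp add: lp_def lp_norm_def)
qed

definition E_map :: "(nat \<Rightarrow> real) \<Rightarrow> (nat \<Rightarrow> real) \<Rightarrow> nat \<Rightarrow> real" where
  "E_map lam x n =
     1 / lam n * (\<Sum>k=0..n. (lam k - prev lam k) *
        (fibo k / fibo (k+1) * x k - fibo (k+1) / fibo k * prev x k))"

definition lpF :: "(nat \<Rightarrow> real) \<Rightarrow> ennreal \<Rightarrow> (nat \<Rightarrow> real) set" where
  "lpF lam p = {x. E_map lam x \<in> lp p}"

definition lpF_norm :: "(nat \<Rightarrow> real) \<Rightarrow> ennreal \<Rightarrow> (nat \<Rightarrow> real) \<Rightarrow> ennreal" where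
  "lpF_norm lam p x = lp_norm p (E_map lam x)"

definition mat_map :: "(nat \<Rightarrow> nat \<Rightarrow> real) \<Rightarrow> (nat \<Rightarrow> real) \<Rightarrow> nat \<Rightarrow> real" where
  "mat_map A x n = (\<Sum>k. A n k * x k)"

definition mat_class ::
    "(nat \<Rightarrow> real) set \<Rightarrow> (nat \<Rightarrow> real) set \<Rightarrow> (nat \<Rightarrow> nat \<Rightarrow> real) set" where
  "mat_class X Y =
     {A. \<forall>x\<in>X. (\<forall>n. summable (\<lambda>k. A n k * x k)) \<and> mat_map A x \<in> Y}"

text \<open>Operator norm of \<open>L\<close> on the sequence space \<open>X\<close> with norm \<open>nX\<close>, the values being
  measured by \<open>nY\<close>. The library's \<^const>\<open>onorm\<close> is not applicable, as the spaces are sets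
  depending on parameters and not types; \<open>L\<close> is bounded iff the value is finite.\<close>

definition op_norm :: "(nat \<Rightarrow> real) set \<Rightarrow> ((nat \<Rightarrow> real) \<Rightarrow> ennreal) \<Rightarrow>
    ((nat \<Rightarrow> real) \<Rightarrow> ennreal) \<Rightarrow> ((nat \<Rightarrow> real) \<Rightarrow> nat \<Rightarrow> real) \<Rightarrow> ennreal" where
  "op_norm X nX nY L = (SUP x\<in>{x\<in>X. nX x \<le> 1}. nY (L x))"

text \<open>The sum over \<open>j \<ge> k + 1\<close> is reindexed to start from 0.\<close>

definition a_hat :: "(nat \<Rightarrow> real) \<Rightarrow> (nat \<Rightarrow> nat \<Rightarrow> real) \<Rightarrow> nat \<Rightarrow> nat \<Rightarrow> real" where
  "a_hat lam A n k =
     lam k * ((fibo (k+1))\<^sup>2 * A n k / ((lam k - prev lam k) * fibo k * fibo (k+1))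
       + (1 / ((lam k - prev lam k) * fibo k * fibo (k+1))
          - 1 / ((lam (k+1) - lam k) * fibo (k+1) * fibo (k+2)))
         * (\<Sum>i. (fibo ((k+1+i) + 1))\<^sup>2 * A n (k+1+i)))"

text \<open>In the next two definitions \<open>q\<close> is the conjugate exponent of \<open>p\<close>.\<close>

definition mat_norm_linf ::
    "(nat \<Rightarrow> real) \<Rightarrow> ennreal \<Rightarrow> ennreal \<Rightarrow> (nat \<Rightarrow> nat \<Rightarrow> real) \<Rightarrow> ennreal" where
  "mat_norm_linf lam p q A =
     (if p = \<infinity> then (SUP n. \<Sum>k. ennreal \<bar>a_hat lam A n k\<bar>)
      else if p = 1 then (SUP k. SUP n. ennreal \<bar>a_hat lam A n k\<bar>)
      else (SUP n. ennpowr (\<Sum>k. ennreal (\<bar>a_hat lam A n k\<bar> powr enn2real q))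
                           (1 / enn2real q)))"

definition mat_norm_l1 ::
    "(nat \<Rightarrow> real) \<Rightarrow> ennreal \<Rightarrow> ennreal \<Rightarrow> (nat \<Rightarrow> nat \<Rightarrow> real) \<Rightarrow> ennreal" where
  "mat_norm_l1 lam p q A =
     (if p = \<infinity> then (SUP N\<in>{N. finite N}. \<Sum>k. ennreal \<bar>\<Sum>n\<in>N. a_hat lam A n k\<bar>)
      else if p = 1 then (SUP k. \<Sum>n. ennreal \<bar>a_hat lam A n k\<bar>)
      else (SUP N\<in>{N. finite N}.
              ennpowr (\<Sum>k. ennreal (\<bar>\<Sum>n\<in>N. a_hat lam A n k\<bar> powr enn2real q))
                      (1 / enn2real q)))"

end

theory Submission
  imports Defs
begin

text \<open>The map \<open>E\<close> is a bijection of the space of all sequences, so with \<open>y = E x\<close> everything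
  reduces to functionals on \<open>\<ell>\<^sub>p\<close>. Summation by parts gives
  \<open>\<Sum>\<^sub>k\<^sub><\<^sub>m a\<^sub>n\<^sub>k x\<^sub>k = \<Sum>\<^sub>k\<^sub><\<^sub>m (a_hat)\<^sub>n\<^sub>k y\<^sub>k + r\<^sub>m \<Sum>\<^sub>k\<^sub><\<^sub>m c\<^sub>k y\<^sub>k\<close> with \<open>r\<^sub>m \<rightarrow> 0\<close>, where \<open>c\<^sub>k\<close> is
  \<open>weight_diff\<close> and \<open>r\<^sub>m\<close> is minus the tail of the series occurring in \<open>a_hat\<close>. By uniform boundedness
  each row is a bounded functional, hence the remainder vanishes in the limit: by density of the
  finitely supported sequences if \<open>p < \<infinity>\<close>, and by a gliding hump if \<open>p = \<infinity>\<close>. So \<open>A x\<close> is the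
  matrix \<open>a_hat\<close> applied to \<open>y\<close>, and the norms of its rows are computed by \<open>\<ell>\<^sub>p\<close>-\<open>\<ell>\<^sub>q\<close> duality. For the
  target \<open>\<ell>\<^sub>1\<close>, one applies this to the functionals \<open>\<Sum>\<^sub>n\<^sub>\<in>\<^sub>N A\<^sub>n\<close> and splits a sum of absolute values by sign,
  which gives the upper bound even with the constant 2 in place of 4.\<close>

section \<open>Uniform boundedness over an abstract unit ball of sequences\<close>

locale seq_unit_ball =
  fixes B :: "(nat \<Rightarrow> real) set"
  assumes zero_mem: "(\<lambda>_. 0) \<in> B"
    and convex_mem: "\<lbrakk>x \<in> B; y \<in> B; 0 \<le> t; t \<le> 1\<rbrakk> \<Longrightarrow> (\<lambda>k. t * x k + (1 - t) * y k) \<in> B"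
    and uminus_mem: "x \<in> B \<Longrightarrow> (\<lambda>k. - x k) \<in> B"
    and lim_mem: "\<lbrakk>\<And>n. z n \<in> B; \<And>k. (\<lambda>n. z n k) \<longlonglongrightarrow> y k\<rbrakk> \<Longrightarrow> y \<in> B"
    and abs_le_one: "x \<in> B \<Longrightarrow> \<bar>x k\<bar> \<le> 1"
begin

text \<open>The span of \<open>B\<close>: as \<open>B\<close> is convex and symmetric, its
  nonnegative multiples already form a linear space.\<close>

definition space :: "(nat \<Rightarrow> real) set" where
  "space = {(\<lambda>k. c * u k) | c u. 0 \<le> c \<and> u \<in> B}"

definition linear_functional :: "((nat \<Rightarrow> real) \<Rightarrow> real) \<Rightarrow> bool" where
  "linear_functional \<phi> \<longleftrightarrow>
     (\<forall>x\<in>space. \<forall>y\<in>space. \<forall>a b. \<phi> (\<lambda>k. a * x k + b * y k) = a * \<phi> x + b * \<phi> y)"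

lemma mem_space: "u \<in> B \<Longrightarrow> u \<in> space"
  unfolding space_def by (auto intro!: exI[of _ 1] exI[of _ u])

lemma space_scale:
  assumes "x \<in> space"
  shows "(\<lambda>k. a * x k) \<in> space"
proof -
  obtain c u where u: "0 \<le> c" "u \<in> B" "x = (\<lambda>k. c * u k)"
    using assms by (auto simp: space_def)
  show ?thesis
  proof (cases "0 \<le> a")
    case True
    with u show ?thesis
      unfolding space_def by (auto intro!: exI[of _ "a * c"] exI[of _ u])
  next
    case False
    with u uminus_mem[OF u(2)] show ?thesis
      unfolding space_def
      by (auto intro!: exI[of _ "- a * c"] exI[of _ "\<lambda>k. - u k"] simp: mult_nonpos_nonneg)
  qed
qed

lemma space_add:
  assumes "x \<in> space" "y \<in> space"
  shows "(\<lambda>k. x k + y k) \<in> space"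
proof -
  obtain c u where u: "0 \<le> c" "u \<in> B" "x = (\<lambda>k. c * u k)"
    using assms(1) by (auto simp: space_def)
  obtain d v where v: "0 \<le> d" "v \<in> B" "y = (\<lambda>k. d * v k)"
    using assms(2) by (auto simp: space_def)
  show ?thesis
  proof (cases "c + d = 0")
    case True
    with u v have "c = 0" "d = 0" by auto
    with u v mem_space[OF zero_mem] show ?thesis by simp
  next
    case False
    with u v have pos: "0 < c + d" by auto
    define w where "w = (\<lambda>k. c / (c + d) * u k + (1 - c / (c + d)) * v k)"
    have "w \<in> B"
      unfolding w_def using u v pos by (intro convex_mem) auto
    moreover have "(\<lambda>k. x k + y k) = (\<lambda>k. (c + d) * w k)"
    proof
      fix k
      have "(c + d) * w k = (c + d) * (c / (c + d)) * u k + (c + d) * (1 - c / (c + d)) * v k"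
        by (simp only: w_def ring_distribs mult.assoc)
      also have "(c + d) * (c / (c + d)) = c" using pos by simp
      also have "(c + d) * (1 - c / (c + d)) = d" using pos by (simp add: right_diff_distrib)
      finally show "x k + y k = (c + d) * w k" by (simp add: u v)
    qed
    ultimately show ?thesis
      unfolding space_def using pos by (auto intro!: exI[of _ "c + d"] exI[of _ w])
  qed
qed

lemma space_comb:
  "x \<in> space \<Longrightarrow> y \<in> space \<Longrightarrow> (\<lambda>k. a * x k + b * y k) \<in> space"
  by (intro space_add space_scale)

text \<open>The weights \<open>2 * (1/3) ^ Suc l\<close> sum to 1, so this is an infinite convex
  combination. In a partial sum the zero sequence carries the missing weight, and
  \<open>lim_mem\<close> then passes to the limit; it takes the place of completeness.\<close>

lemma geometric_sum_mem:
  assumes "\<And>l. w l \<in> B"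
  shows "(\<lambda>k. \<Sum>l. 2 * (1/3) ^ Suc l * w l k) \<in> B"
proof (rule lim_mem)
  show "(\<lambda>k. \<Sum>l<n. 2 * (1/3) ^ Suc l * w l k) \<in> B" for n
    using assms
  proof (induction n arbitrary: w)
    case 0
    show ?case using zero_mem by simp
  next
    case (Suc n)
    have "(\<lambda>k. (2/3) * w 0 k + (1 - 2/3) * (\<Sum>l<n. 2 * (1/3) ^ Suc l * w (Suc l) k)) \<in> B"
      using Suc.prems Suc.IH[of "\<lambda>l. w (Suc l)"] by (intro convex_mem) auto
    then show ?case
      by (subst sum.lessThan_Suc_shift) (simp add: sum_distrib_left mult_ac sum_divide_distrib)
  qed
  show "(\<lambda>n. \<Sum>l<n. 2 * (1/3) ^ Suc l * w l k) \<longlonglongrightarrow> (\<Sum>l. 2 * (1/3) ^ Suc l * w l k)" for k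
  proof (rule summable_LIMSEQ, rule summable_comparison_test')
    show "summable (\<lambda>l. 2 * (1/3::real) ^ Suc l)"
      by (intro summable_mult) (simp add: summable_geometric)
    show "norm (2 * (1/3) ^ Suc l * w l k) \<le> 2 * (1/3) ^ Suc l" if "0 \<le> l" for l
      using abs_le_one[OF assms, of l k] by (simp add: abs_mult mult_left_le)
  qed
qed

text \<open>The sign of each step is chosen so that it does not decrease the functional; the tail of
  the geometric series is then too small to undo the last step (Sokal's proof).\<close>

theorem uniform_boundedness:
  fixes \<phi> :: "'i \<Rightarrow> (nat \<Rightarrow> real) \<Rightarrow> real"
  assumes lin: "\<And>i. linear_functional (\<phi> i)"
    and bdd: "\<And>i. \<exists>C. \<forall>y\<in>B. \<bar>\<phi> i y\<bar> \<le> C"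
    and ptw: "\<And>y. y \<in> space \<Longrightarrow> \<exists>K. \<forall>i. \<bar>\<phi> i y\<bar> \<le> K"
  shows "\<exists>C. \<forall>i. \<forall>y\<in>B. \<bar>\<phi> i y\<bar> \<le> C"
proof (rule ccontr)
  assume unb: "\<nexists>C. \<forall>i. \<forall>y\<in>B. \<bar>\<phi> i y\<bar> \<le> C"
  have Bne: "B \<noteq> {}" using zero_mem by auto
  define M where "M i = (SUP y\<in>B. \<bar>\<phi> i y\<bar>)" for i
  have bddA: "bdd_above ((\<lambda>y. \<bar>\<phi> i y\<bar>) ` B)" for i
    using bdd[of i] by (auto simp: bdd_above_def)
  have M_upper: "\<bar>\<phi> i y\<bar> \<le> M i" if "y \<in> B" for i y
    unfolding M_def using that bddA by (rule cSUP_upper)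
  \<comment> \<open>\<open>M i\<close> is the norm of the functional. The growth
    \<open>4 ^ j\<close> has to beat the scale \<open>(1/3) ^ j\<close> of the steps below, and 3/4
    leaves a margin over the 1/2 that the tail can cost.\<close>
  have "\<exists>i. \<exists>y\<in>B. 4 * 4 ^ j < M i \<and> 3/4 * M i \<le> \<bar>\<phi> i y\<bar>" for j :: nat
  proof -
    obtain i y where i: "y \<in> B" "4 * 4 ^ j < \<bar>\<phi> i y\<bar>"
      using unb by (meson linorder_not_le)
    have less: "4 * 4 ^ j < M i" using i M_upper[OF i(1), of i] by linarith
    then have "0 < M i" by (smt (verit) zero_less_power)
    then have "3/4 * M i < M i" by simp
    then obtain v where "v \<in> B" "3/4 * M i < \<bar>\<phi> i v\<bar>"
      unfolding M_def using less_cSUP_iff[OF Bne bddA[of i]] by auto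
    with less show ?thesis by (auto intro: less_imp_le)
  qed
  then obtain f v where v: "\<And>j. v j \<in> B" and big: "\<And>j. 4 * 4 ^ j < M (f j)"
    and near: "\<And>j. 3/4 * M (f j) \<le> \<bar>\<phi> (f j) (v j)\<bar>"
    by metis
  define \<psi> where "\<psi> j = \<phi> (f j)" for j
  have lin': "\<psi> j (\<lambda>k. a * x k + b * y k) = a * \<psi> j x + b * \<psi> j y"
    if "x \<in> space" "y \<in> space" for j a b x y
    using lin[of "f j"] that by (auto simp: \<psi>_def linear_functional_def)
  define step :: "nat \<Rightarrow> (nat \<Rightarrow> real) \<Rightarrow> real" where
    "step j x = (if \<bar>\<psi> j (\<lambda>k. x k + (1/3) ^ j * v j k)\<bar> \<ge> \<bar>\<psi> j (\<lambda>k. x k - (1/3) ^ j * v j k)\<bar>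
                 then 1 else -1)" for j x
  define X where "X = rec_nat (\<lambda>_. 0) (\<lambda>j x k. x k + (1/3) ^ j * (step j x * v j k))"
  have X0: "X 0 = (\<lambda>_. 0)" and XS: "X (Suc j) = (\<lambda>k. X j k + (1/3) ^ j * (step j (X j) * v j k))" for j
    by (simp_all add: X_def)
  define z where "z j = (\<lambda>k. step j (X j) * v j k)" for j
  have zB: "z j \<in> B" for j
    using v[of j] uminus_mem[OF v[of j]] by (simp add: z_def step_def)
  have X_sum: "X j = (\<lambda>k. \<Sum>l<j. (1/3) ^ l * z l k)" for j
    by (induction j) (auto simp: X0 XS z_def)
  have X_space: "X j \<in> space" for j
  proof (induction j)
    case 0 then show ?case using mem_space[OF zero_mem] by (simp add: X0)
  next
    case (Suc j)
    have "(\<lambda>k. X j k + (1/3) ^ j * z j k) \<in> space"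
      using Suc mem_space[OF zB] by (intro space_add space_scale)
    then show ?case by (simp add: XS z_def)
  qed
  have grow: "\<bar>\<psi> j (X (Suc j))\<bar> \<ge> (1/3) ^ j * (3/4 * M (f j))" for j
  proof -
    let ?t = "(1/3) ^ j :: real"
    have vs: "v j \<in> space" by (rule mem_space[OF v])
    have p: "\<psi> j (\<lambda>k. X j k + ?t * v j k) = \<psi> j (X j) + ?t * \<psi> j (v j)"
      using lin'[OF X_space[of j] vs, of j 1 ?t] by simp
    have m: "\<psi> j (\<lambda>k. X j k - ?t * v j k) = \<psi> j (X j) - ?t * \<psi> j (v j)"
      using lin'[OF X_space[of j] vs, of j 1 "- ?t"] by simp
    have "\<bar>\<psi> j (X (Suc j))\<bar> = max \<bar>\<psi> j (X j) + ?t * \<psi> j (v j)\<bar> \<bar>\<psi> j (X j) - ?t * \<psi> j (v j)\<bar>"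
      unfolding XS step_def by (auto simp: p m)
    also have "\<dots> \<ge> \<bar>?t * \<psi> j (v j)\<bar>" by linarith
    also have "\<bar>?t * \<psi> j (v j)\<bar> = ?t * \<bar>\<psi> j (v j)\<bar>" by (simp add: abs_mult)
    finally have "?t * \<bar>\<psi> j (v j)\<bar> \<le> \<bar>\<psi> j (X (Suc j))\<bar>" .
    moreover have "?t * (3/4 * M (f j)) \<le> ?t * \<bar>\<psi> j (v j)\<bar>"
      using near[of j] by (intro mult_left_mono) (auto simp: \<psi>_def)
    ultimately show ?thesis by linarith
  qed
  define x where "x = (\<lambda>k. \<Sum>l. (1/3) ^ l * z l k)"
  \<comment> \<open>The tail of \<open>x\<close> from index \<open>j\<close> on, divided by its
    total weight \<open>3/2 * (1/3) ^ j\<close> and hence an element of \<open>B\<close>.\<close>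
  define u where "u j = (\<lambda>k. \<Sum>l. 2 * (1/3) ^ Suc l * z (l + j) k)" for j
  have uB: "u j \<in> B" for j
    unfolding u_def by (rule geometric_sum_mem[OF zB])
  have summ: "summable (\<lambda>l. (1/3) ^ l * z l k)" for k
  proof (rule summable_comparison_test')
    show "summable (\<lambda>l. (1/3::real) ^ l)" by (simp add: summable_geometric)
    show "norm ((1/3) ^ l * z l k) \<le> (1/3) ^ l" if "0 \<le> l" for l
      using abs_le_one[OF zB, of l k] by (simp add: abs_mult mult_left_le)
  qed
  have x_split: "x = (\<lambda>k. 1 * X j k + (3/2 * (1/3) ^ j) * u j k)" for j
  proof
    fix k
    have "x k = (\<Sum>l. (1/3) ^ (l + j) * z (l + j) k) + X j k"
      unfolding x_def X_sum by (rule suminf_split_initial_segment[OF summ])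
    also have "(\<Sum>l. (1/3) ^ (l + j) * z (l + j) k)
        = (\<Sum>l. (3/2 * (1/3) ^ j) * (2 * (1/3) ^ Suc l * z (l + j) k))"
      by (simp add: power_add mult_ac)
    also have "\<dots> = (3/2 * (1/3) ^ j) * u j k"
    proof -
      have "summable (\<lambda>l. (1/3) ^ (l + j) * z (l + j) k)"
        using summ summable_ignore_initial_segment[of _ j] by blast
      then have "summable (\<lambda>l. (2/3 * 3 ^ j) * ((1/3) ^ (l + j) * z (l + j) k))"
        by (rule summable_mult)
      then have "summable (\<lambda>l. 2 * (1/3) ^ Suc l * z (l + j) k)"
        by (simp add: power_add field_simps)
      then show ?thesis unfolding u_def by (rule suminf_mult[symmetric, THEN sym])
    qed
    finally show "x k = 1 * X j k + (3/2 * (1/3) ^ j) * u j k" by simp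
  qed
  have "x \<in> space"
    unfolding x_split[of 0] by (intro space_comb X_space mem_space uB)
  then obtain K where K: "\<And>i. \<bar>\<phi> i x\<bar> \<le> K" using ptw by blast
  \<comment> \<open>The tail from \<open>Suc j\<close> has weight \<open>1/2 * (1/3) ^ j\<close>. Of
    the gain 3/4 there remains a quarter of \<open>M (f j)\<close>, which exceeds
    \<open>4 ^ j\<close>.\<close>
  have "(4/3) ^ j \<le> K" for j
  proof -
    let ?t = "(1/3) ^ j :: real"
    have "\<psi> j x = \<psi> j (X (Suc j)) + (3/2 * (1/3) ^ Suc j) * \<psi> j (u (Suc j))"
      using lin'[OF X_space mem_space[OF uB], of j 1 "Suc j" "3/2 * (1/3) ^ Suc j" "Suc j"]
      by (subst x_split[of "Suc j"]) simp
    then have "\<psi> j x = \<psi> j (X (Suc j)) + (1/2) * (?t * \<psi> j (u (Suc j)))"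
      by simp
    moreover have "\<bar>?t * \<psi> j (u (Suc j))\<bar> \<le> ?t * M (f j)"
      using M_upper[OF uB[of "Suc j"], of "f j"] by (simp add: abs_mult \<psi>_def)
    ultimately have "\<bar>\<psi> j x\<bar> \<ge> ?t * (3/4 * M (f j)) - 1/2 * (?t * M (f j))"
      using grow[of j] by linarith
    also have "?t * (3/4 * M (f j)) - 1/2 * (?t * M (f j)) = ?t * (M (f j) / 4)"
      by (simp add: algebra_simps)
    finally have "?t * (M (f j) / 4) \<le> K" using K[of "f j"] by (simp add: \<psi>_def)
    moreover have "?t * 4 ^ j \<le> ?t * (M (f j) / 4)"
      using big[of j] by (intro mult_left_mono) auto
    moreover have "?t * 4 ^ j = (4/3) ^ j" by (simp add: power_divide)
    ultimately show ?thesis by linarith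
  qed
  moreover obtain j where "K < (4/3) ^ j" using real_arch_pow[of "4/3" K] by auto
  ultimately show False by (meson linorder_not_le)
qed

end

section \<open>Norm bounds and unit balls in the lp spaces\<close>

definition unit_ball :: "ennreal \<Rightarrow> (nat \<Rightarrow> real) set" where
  "unit_ball p = {y. lp_norm p y \<le> 1}"

lemma suminf_ennreal_le_iff:
  assumes "\<And>k. 0 \<le> g k" "0 \<le> C"
  shows "(\<Sum>k. ennreal (g k)) \<le> ennreal C \<longleftrightarrow> (\<forall>m. sum g {..<m} \<le> C)"
  using assms by (simp add: suminf_eq_SUP SUP_le_iff sum_ennreal sum_nonneg)

lemma lp_norm_infinity_le_iff:
  assumes "0 \<le> C"
  shows "lp_norm top y \<le> ennreal C \<longleftrightarrow> (\<forall>k. \<bar>y k\<bar> \<le> C)"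
  using assms by (simp add: lp_norm_def SUP_le_iff)

text \<open>Trades the root and the infinite sum for real inequalities on partial sums, the form in
  which finite exponents are mostly handled below.\<close>

lemma lp_norm_ennreal_le_iff:
  assumes r: "0 < r" and C: "0 \<le> C"
  shows "lp_norm (ennreal r) y \<le> ennreal C \<longleftrightarrow> (\<forall>m. (\<Sum>k<m. \<bar>y k\<bar> powr r) \<le> C powr r)"
proof -
  let ?S = "\<Sum>k. ennreal (\<bar>y k\<bar> powr r)"
  have "lp_norm (ennreal r) y = ennpowr ?S (1 / r)"
    using r by (simp add: lp_norm_def)
  also have "\<dots> \<le> ennreal C \<longleftrightarrow> ?S \<le> ennreal (C powr r)"
  proof (cases ?S)
    case (real s)
    have "s powr (1 / r) \<le> C \<longleftrightarrow> s \<le> C powr r"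
    proof
      assume "s powr (1 / r) \<le> C"
      then have "(s powr (1 / r)) powr r \<le> C powr r" using r by (intro powr_mono2) auto
      then show "s \<le> C powr r" using r real by (simp add: powr_powr)
    next
      assume "s \<le> C powr r"
      then have "s powr (1 / r) \<le> (C powr r) powr (1 / r)" using r real by (intro powr_mono2) auto
      then show "s powr (1 / r) \<le> C" using r C by (simp add: powr_powr)
    qed
    with real C show ?thesis by (simp add: ennpowr_def)
  next
    case top
    then show ?thesis by (simp add: ennpowr_def top_unique)
  qed
  also have "\<dots> \<longleftrightarrow> (\<forall>m. (\<Sum>k<m. \<bar>y k\<bar> powr r) \<le> C powr r)"
    by (rule suminf_ennreal_le_iff) auto
  finally show ?thesis .
qed

lemma lp_norm_one: "lp_norm 1 x = (\<Sum>k. ennreal \<bar>x k\<bar>)"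
proof -
  have "ennpowr t 1 = t" for t
    by (cases t) (auto simp: ennpowr_def)
  then show ?thesis by (simp add: lp_norm_def)
qed

lemma exponent_cases:
  fixes p :: ennreal
  assumes "1 \<le> p"
  obtains (infinite) "p = top" | (finite) r where "1 \<le> r" "p = ennreal r"
  using assms by (cases p) auto

text \<open>In \<open>ennreal\<close> one has \<open>1 / \<infinity> = 0\<close> and
  \<open>1 / 0 = \<infinity>\<close>, so the single equation covers both endpoint pairs and excludes
  \<open>q = 0\<close>.\<close>

lemma conjugate_exponent_cases:
  fixes p q :: ennreal
  assumes p: "1 \<le> p" and pq: "1 / p + 1 / q = 1"
  obtains (one) "p = 1" "q = top"
  | (infinite) "p = top" "q = 1"
  | (finite) r s where "1 < r" "1 < s" "1 / r + 1 / s = 1" "p = ennreal r" "q = ennreal s"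
  using p
proof (cases p rule: exponent_cases)
  case infinite
  then have "1 / q = 1" using pq by simp
  then have "q = 1"
  proof (cases q)
    case (real s)
    with \<open>1 / q = 1\<close> have "s \<noteq> 0" by auto
    with real have "ennreal (1 / s) = 1"
      using \<open>1 / q = 1\<close> by (simp add: divide_ennreal flip: ennreal_1)
    then show ?thesis using real by simp
  qed (use \<open>1 / q = 1\<close> in auto)
  with infinite show ?thesis by (rule that(2))
next
  case (finite r)
  show ?thesis
  proof (cases q)
    case top
    then have "1 / p = 1" using pq by simp
    then have "ennreal (1 / r) = 1" using finite by (simp add: divide_ennreal flip: ennreal_1)
    then have "r = 1" using finite by simp
    with finite top show ?thesis by (intro that(1)) auto
  next
    case (real s)
    have "s \<noteq> 0" using pq real by auto
    with real have s: "0 < s" by auto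
    have "ennreal (1 / r + 1 / s) = 1"
      using pq finite s real by (simp add: divide_ennreal ennreal_plus flip: ennreal_1)
    then have eq: "1 / r + 1 / s = 1" by simp
    with s have "1 / r < 1" by (smt (verit) divide_pos_pos)
    then have "1 < r" using finite by simp
    then have "1 / s < 1" using eq by (smt (verit) divide_pos_pos)
    then have "1 < s" using s by simp
    show ?thesis by (rule that(3)[OF \<open>1 < r\<close> \<open>1 < s\<close> eq finite(2) real(2)])
  qed
qed

lemma lp_norm_mono:
  assumes p: "1 \<le> p" and le: "\<And>k. \<bar>x k\<bar> \<le> \<bar>y k\<bar>"
  shows "lp_norm p x \<le> lp_norm p y"
proof (cases "lp_norm p y")
  case (real C)
  show ?thesis
    using p
  proof (cases p rule: exponent_cases)
    case infinite
    with real le show ?thesis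
      by (metis lp_norm_infinity_le_iff order_refl order_trans)
  next
    case (finite r)
    have "(\<Sum>k<m. \<bar>x k\<bar> powr r) \<le> C powr r" for m
    proof -
      have "(\<Sum>k<m. \<bar>x k\<bar> powr r) \<le> (\<Sum>k<m. \<bar>y k\<bar> powr r)"
        using le finite by (intro sum_mono powr_mono2) auto
      also have "\<dots> \<le> C powr r"
        using lp_norm_ennreal_le_iff[of r C y] real finite by auto
      finally show ?thesis .
    qed
    with real finite show ?thesis by (simp add: lp_norm_ennreal_le_iff)
  qed
qed auto

lemma lp_norm_scale_le_iff:
  assumes p: "1 \<le> p" and c: "0 < c" and C: "0 \<le> C"
  shows "lp_norm p (\<lambda>k. c * y k) \<le> ennreal (c * C) \<longleftrightarrow> lp_norm p y \<le> ennreal C"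
  using p
proof (cases p rule: exponent_cases)
  case infinite
  with c C show ?thesis by (simp add: lp_norm_infinity_le_iff abs_mult)
next
  case (finite r)
  with c C show ?thesis
    by (simp add: lp_norm_ennreal_le_iff abs_mult powr_mult flip: sum_distrib_left)
qed

text \<open>For positive arguments this is convexity of the power function. If an argument is 0, it
  reduces to \<open>s powr r \<le> s\<close> on the unit interval.\<close>

lemma convex_powr_Ici:
  fixes x y t r :: real
  assumes "1 \<le> r" "0 \<le> x" "0 \<le> y" "0 \<le> t" "t \<le> 1"
  shows "(t * x + (1 - t) * y) powr r \<le> t * x powr r + (1 - t) * y powr r"
proof -
  have *: "(s * z) powr r \<le> s * z powr r" if "0 \<le> s" "s \<le> 1" "0 \<le> z" for s z :: real
  proof -
    have "s powr r \<le> s powr 1" using that assms(1) by (intro powr_mono') auto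
    then show ?thesis using that by (simp add: powr_mult mult_right_mono)
  qed
  show ?thesis
  proof (cases "x = 0 \<or> y = 0")
    case True
    then show ?thesis using *[of t x] *[of "1 - t" y] assms by auto
  next
    case False
    then show ?thesis
      using convex_onD[OF powr_convex[OF assms(1)], of "1 - t" x y] assms by simp
  qed
qed

lemma unit_ball_infinity_iff: "y \<in> unit_ball top \<longleftrightarrow> (\<forall>k. \<bar>y k\<bar> \<le> 1)"
  using lp_norm_infinity_le_iff[of 1 y] by (simp add: unit_ball_def)

lemma unit_ball_ennreal_iff:
  "0 < r \<Longrightarrow> y \<in> unit_ball (ennreal r) \<longleftrightarrow> (\<forall>m. (\<Sum>k<m. \<bar>y k\<bar> powr r) \<le> 1)"
  using lp_norm_ennreal_le_iff[of r 1 y] by (simp add: unit_ball_def)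

text \<open>For finite exponents convexity is obtained termwise from that of the power function,
  without Minkowski's inequality. Coordinatewise limits stay in the ball because membership is a
  family of closed conditions, each on finitely many coordinates.\<close>

lemma seq_unit_ball_unit_ball:
  assumes "1 \<le> p"
  shows "seq_unit_ball (unit_ball p)"
  using assms
proof (cases p rule: exponent_cases)
  case infinite
  show ?thesis
    unfolding infinite
  proof
    fix x y :: "nat \<Rightarrow> real" and t :: real
    assume "x \<in> unit_ball top" "y \<in> unit_ball top" and t: "0 \<le> t" "t \<le> 1"
    then have "\<bar>t * x k + (1 - t) * y k\<bar> \<le> 1" for k
      using convex_bound_le[of "\<bar>x k\<bar>" 1 "\<bar>y k\<bar>" t "1 - t"]
        abs_triangle_ineq[of "t * x k" "(1 - t) * y k"]
      by (simp add: unit_ball_infinity_iff abs_mult)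
    then show "(\<lambda>k. t * x k + (1 - t) * y k) \<in> unit_ball top"
      by (simp add: unit_ball_infinity_iff)
  next
    fix z :: "nat \<Rightarrow> nat \<Rightarrow> real" and y
    assume z: "\<And>n. z n \<in> unit_ball top" and lim: "\<And>k. (\<lambda>n. z n k) \<longlonglongrightarrow> y k"
    have "\<bar>y k\<bar> \<le> 1" for k
      using z by (intro LIMSEQ_le_const2[OF tendsto_rabs[OF lim[of k]]])
        (auto simp: unit_ball_infinity_iff)
    then show "y \<in> unit_ball top" by (simp add: unit_ball_infinity_iff)
  qed (auto simp: unit_ball_infinity_iff)
next
  case (finite r)
  then have r: "0 < r" by simp
  note iff = unit_ball_ennreal_iff[OF r]
  show ?thesis
    unfolding finite(2)
  proof
    show "(\<lambda>_. 0) \<in> unit_ball (ennreal r)" by (simp add: iff)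
  next
    fix x y :: "nat \<Rightarrow> real" and t :: real
    assume xy: "x \<in> unit_ball (ennreal r)" "y \<in> unit_ball (ennreal r)" and t: "0 \<le> t" "t \<le> 1"
    have "(\<Sum>k<m. \<bar>t * x k + (1 - t) * y k\<bar> powr r) \<le> 1" for m
    proof -
      have "\<bar>t * x k + (1 - t) * y k\<bar> powr r \<le> t * \<bar>x k\<bar> powr r + (1 - t) * \<bar>y k\<bar> powr r" for k
      proof -
        have "\<bar>t * x k + (1 - t) * y k\<bar> powr r \<le> (t * \<bar>x k\<bar> + (1 - t) * \<bar>y k\<bar>) powr r"
          using abs_triangle_ineq[of "t * x k" "(1 - t) * y k"] t r
          by (intro powr_mono2) (auto simp: abs_mult)
        also have "\<dots> \<le> t * \<bar>x k\<bar> powr r + (1 - t) * \<bar>y k\<bar> powr r"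
          using finite t by (intro convex_powr_Ici) auto
        finally show ?thesis .
      qed
      then have "(\<Sum>k<m. \<bar>t * x k + (1 - t) * y k\<bar> powr r)
          \<le> (\<Sum>k<m. t * \<bar>x k\<bar> powr r + (1 - t) * \<bar>y k\<bar> powr r)"
        by (intro sum_mono)
      also have "\<dots> = t * (\<Sum>k<m. \<bar>x k\<bar> powr r) + (1 - t) * (\<Sum>k<m. \<bar>y k\<bar> powr r)"
        by (simp add: sum.distrib sum_distrib_left)
      also have "\<dots> \<le> 1"
        using xy t by (intro convex_bound_le) (auto simp: iff)
      finally show ?thesis .
    qed
    then show "(\<lambda>k. t * x k + (1 - t) * y k) \<in> unit_ball (ennreal r)" by (simp add: iff)
  next
    show "(\<lambda>k. - x k) \<in> unit_ball (ennreal r)" if "x \<in> unit_ball (ennreal r)" for x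
      using that by (simp add: iff)
  next
    fix z :: "nat \<Rightarrow> nat \<Rightarrow> real" and y
    assume z: "\<And>n. z n \<in> unit_ball (ennreal r)" and lim: "\<And>k. (\<lambda>n. z n k) \<longlonglongrightarrow> y k"
    have "(\<Sum>k<m. \<bar>y k\<bar> powr r) \<le> 1" for m
    proof (rule LIMSEQ_le_const2)
      show "(\<lambda>n. \<Sum>k<m. \<bar>z n k\<bar> powr r) \<longlonglongrightarrow> (\<Sum>k<m. \<bar>y k\<bar> powr r)"
        using r by (intro tendsto_sum tendsto_powr2 tendsto_rabs lim tendsto_const) auto
      show "\<exists>N. \<forall>n\<ge>N. (\<Sum>k<m. \<bar>z n k\<bar> powr r) \<le> 1" using z by (auto simp: iff)
    qed
    then show "y \<in> unit_ball (ennreal r)" by (simp add: iff)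
  next
    fix x k assume "x \<in> unit_ball (ennreal r)"
    then have "(\<Sum>k<Suc k. \<bar>x k\<bar> powr r) \<le> 1" unfolding iff by blast
    moreover have "0 \<le> (\<Sum>k<k. \<bar>x k\<bar> powr r)" by (simp add: sum_nonneg)
    ultimately have "\<bar>x k\<bar> powr r \<le> 1" by simp
    then have "(\<bar>x k\<bar> powr r) powr (1 / r) \<le> 1 powr (1 / r)" using r by (intro powr_mono2) auto
    then show "\<bar>x k\<bar> \<le> 1" using r by (simp add: powr_powr)
  qed
qed

lemma space_unit_ball:
  assumes p: "1 \<le> p"
  shows "seq_unit_ball.space (unit_ball p) = lp p"
proof -
  interpret seq_unit_ball "unit_ball p" by (rule seq_unit_ball_unit_ball[OF p])
  show ?thesis
  proof (intro equalityI subsetI)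
    fix x assume "x \<in> space"
    then obtain c u where u: "0 \<le> c" "u \<in> unit_ball p" "x = (\<lambda>k. c * u k)"
      by (auto simp: space_def)
    have "lp_norm p x \<le> lp_norm p (\<lambda>k. (c + 1) * u k)"
      using u p by (intro lp_norm_mono) (auto simp: abs_mult mult_right_mono)
    also have "\<dots> \<le> ennreal ((c + 1) * 1)"
      using u p by (subst lp_norm_scale_le_iff) (auto simp: unit_ball_def)
    also have "\<dots> < \<infinity>" by simp
    finally show "x \<in> lp p" by (simp add: lp_def)
  next
    fix x assume "x \<in> lp p"
    then obtain C where C: "lp_norm p x = ennreal C" "0 \<le> C"
      by (auto simp: lp_def less_top_ennreal)
    \<comment> \<open>Dividing by \<open>C + 1\<close> instead of the norm \<open>C\<close> covers
      the zero sequence as well.\<close>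
    define u where "u = (\<lambda>k. x k / (C + 1))"
    have x: "x = (\<lambda>k. (C + 1) * u k)" using C by (auto simp: u_def)
    have "lp_norm p (\<lambda>k. (C + 1) * u k) \<le> ennreal ((C + 1) * 1)"
      using C unfolding x[symmetric] by (auto intro: ennreal_leI)
    then have "u \<in> unit_ball p"
      using C p by (subst (asm) lp_norm_scale_le_iff) (auto simp: unit_ball_def)
    with x C show "x \<in> space"
      unfolding space_def by (auto intro!: exI[of _ "C + 1"] exI[of _ u])
  qed
qed

lemma unit_ball_mono:
  "1 \<le> p \<Longrightarrow> y \<in> unit_ball p \<Longrightarrow> (\<And>k. \<bar>x k\<bar> \<le> \<bar>y k\<bar>) \<Longrightarrow> x \<in> unit_ball p"
  unfolding unit_ball_def using lp_norm_mono order_trans by blast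

lemma unit_vector_mem_unit_ball:
  assumes p: "1 \<le> p"
  shows "(\<lambda>k. if k = j then 1 else 0) \<in> unit_ball p"
  using p
proof (cases p rule: exponent_cases)
  case infinite then show ?thesis by (simp add: unit_ball_infinity_iff)
next
  case (finite r)
  have "\<bar>if k = j then 1 else 0 :: real\<bar> powr r = (if k = j then 1 else 0)" for k by simp
  then have "(\<Sum>k<m. \<bar>if k = j then 1 else 0 :: real\<bar> powr r) \<le> 1" for m by (simp only:) simp
  then show ?thesis using finite by (subst finite(2), subst unit_ball_ennreal_iff) auto
qed

section \<open>Duality of lp and lq\<close>

text \<open>For finite exponents above 1, Young's inequality is applied to
  \<open>\<bar>y k\<bar>\<close> and \<open>\<bar>a k\<bar> / M\<close> and summed; the weights
  \<open>1 / r\<close> and \<open>1 / s\<close> add up to 1.\<close>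

lemma Holder_unit_ball:
  assumes p: "1 \<le> p" and pq: "1 / p + 1 / q = 1"
    and M: "0 \<le> M" "lp_norm q a \<le> ennreal M" and y: "y \<in> unit_ball p"
  shows "(\<Sum>k<m. \<bar>a k * y k\<bar>) \<le> M"
  using p pq
proof (cases rule: conjugate_exponent_cases)
  case one
  have a: "\<bar>a k\<bar> \<le> M" for k using M one by (simp add: lp_norm_infinity_le_iff)
  have "(\<Sum>k<m. \<bar>a k * y k\<bar>) \<le> (\<Sum>k<m. M * \<bar>y k\<bar>)"
    using a by (intro sum_mono) (simp add: abs_mult mult_right_mono)
  also have "\<dots> = M * (\<Sum>k<m. \<bar>y k\<bar>)" by (simp add: sum_distrib_left)
  also have "\<dots> \<le> M * 1"
    using y one M unit_ball_ennreal_iff[of 1 y] by (intro mult_left_mono) auto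
  finally show ?thesis by simp
next
  case infinite
  have "(\<Sum>k<m. \<bar>a k * y k\<bar>) \<le> (\<Sum>k<m. \<bar>a k\<bar>)"
    using y infinite by (intro sum_mono) (simp add: abs_mult unit_ball_infinity_iff mult_left_le)
  also have "\<dots> \<le> M"
    using M infinite lp_norm_ennreal_le_iff[of 1 M a] by auto
  finally show ?thesis .
next
  case (finite r s)
  have Y: "(\<Sum>k<m. \<bar>y k\<bar> powr r) \<le> 1"
    using y finite by (simp add: unit_ball_ennreal_iff)
  have A: "(\<Sum>k<m. \<bar>a k\<bar> powr s) \<le> M powr s" for m
    using M finite by (simp add: lp_norm_ennreal_le_iff)
  show ?thesis
  proof (cases "M = 0")
    \<comment> \<open>Normalising by \<open>M\<close> is impossible here, but all entries of
      \<open>a\<close> vanish.\<close>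
    case True
    have "a k = 0" for k
    proof -
      have "(\<Sum>i<k. \<bar>a i\<bar> powr s) + \<bar>a k\<bar> powr s \<le> 0" using A[of "Suc k"] True finite by simp
      moreover have "0 \<le> (\<Sum>i<k. \<bar>a i\<bar> powr s)" by (simp add: sum_nonneg)
      ultimately have "\<bar>a k\<bar> powr s \<le> 0" by linarith
      then have "\<bar>a k\<bar> powr s = 0" by (intro order_antisym powr_ge_zero)
      then show "a k = 0" by simp
    qed
    then show ?thesis using M by simp
  next
    case False
    then have M0: "0 < M" using M by simp
    have "\<bar>a k * y k\<bar> \<le> M * (\<bar>y k\<bar> powr r / r + (\<bar>a k\<bar> powr s / M powr s) / s)" for k
    proof -
      have "\<bar>y k\<bar> * (\<bar>a k\<bar> / M) \<le> \<bar>y k\<bar> powr r / r + (\<bar>a k\<bar> / M) powr s / s"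
        using finite M0 by (intro Youngs_inequality) auto
      then show ?thesis
        using M0 by (simp add: powr_divide abs_mult field_simps)
    qed
    then have "(\<Sum>k<m. \<bar>a k * y k\<bar>)
        \<le> (\<Sum>k<m. M * (\<bar>y k\<bar> powr r / r + (\<bar>a k\<bar> powr s / M powr s) / s))"
      by (intro sum_mono)
    also have "\<dots> = M * ((\<Sum>k<m. \<bar>y k\<bar> powr r) / r + ((\<Sum>k<m. \<bar>a k\<bar> powr s) / M powr s) / s)"
      by (simp add: sum.distrib sum_divide_distrib flip: sum_distrib_left)
    also have "\<dots> \<le> M * (1 / r + 1 / s)"
      using Y A[of m] M0 finite
      by (intro mult_left_mono add_mono divide_right_mono) auto
    finally show ?thesis using finite by simp
  qed
qed

text \<open>Each case tests the hypothesis on an extremal vector: a signed unit vector, the sign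
  sequence, or the equality case of Hoelder's inequality. Since only finite sums are tested,
  finiteness of the norm is a conclusion.\<close>

lemma lp_norm_le_dual:
  assumes p: "1 \<le> p" and pq: "1 / p + 1 / q = 1"
    and le: "\<And>m y. y \<in> unit_ball p \<Longrightarrow> (\<Sum>k<m. a k * y k) \<le> M"
  shows "lp_norm q a \<le> ennreal M"
proof -
  interpret seq_unit_ball "unit_ball p" by (rule seq_unit_ball_unit_ball[OF p])
  have M: "0 \<le> M" using le[OF zero_mem, of 0] by simp
  show ?thesis
    using p pq
  proof (cases rule: conjugate_exponent_cases)
    case one
    have "\<bar>a j\<bar> \<le> M" for j
    proof -
      have "(\<lambda>k. sgn (a j) * (if k = j then 1 else 0)) \<in> unit_ball p"
        by (rule unit_ball_mono[OF p unit_vector_mem_unit_ball[OF p, of j]])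
          (auto simp: abs_mult abs_sgn_eq)
      from le[OF this, of "Suc j"] show ?thesis
        by (simp add: abs_sgn mult_ac if_distrib cong: if_cong)
    qed
    then show ?thesis using one M by (simp add: lp_norm_infinity_le_iff)
  next
    case infinite
    have "(\<lambda>k. sgn (a k)) \<in> unit_ball p"
      using infinite by (simp add: unit_ball_infinity_iff abs_sgn_eq)
    from le[OF this] have "(\<Sum>k<m. \<bar>a k\<bar>) \<le> M" for m by (simp add: abs_sgn)
    then show ?thesis
      using infinite M lp_norm_ennreal_le_iff[of 1 M a] by auto
  next
    case (finite r s)
    have "(\<Sum>k<m. \<bar>a k\<bar> powr s) \<le> M powr s" for m
    proof (cases "(\<Sum>k<m. \<bar>a k\<bar> powr s) = 0")
      case True then show ?thesis by simp
    next
      case False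
      define S where "S = (\<Sum>k<m. \<bar>a k\<bar> powr s)"
      have S: "0 < S" using False by (simp add: S_def sum_nonneg order_less_le)
      \<comment> \<open>Equality case of Hoelder's inequality, cut off at \<open>m\<close>. As
        \<open>(s - 1) * r = s\<close>, the divisor \<open>S powr (1 / r)\<close> gives it norm
        1.\<close>
      define y where "y k = (if k < m then sgn (a k) * \<bar>a k\<bar> powr (s - 1) / S powr (1 / r) else 0)"
        for k
      have sr: "(s - 1) * r = s"
      proof -
        have "r * s * (1 / r + 1 / s) = r * s" using finite by simp
        then show ?thesis using finite by (simp add: field_simps)
      qed
      have y_powr: "\<bar>y k\<bar> powr r = (if k < m then \<bar>a k\<bar> powr s / S else 0)" for k
        using S finite
        by (auto simp: y_def abs_mult abs_sgn_eq powr_divide powr_powr sr)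
      have "(\<Sum>k<n. \<bar>y k\<bar> powr r) \<le> 1" for n
      proof -
        have "(\<Sum>k<n. \<bar>y k\<bar> powr r) = (\<Sum>k\<in>{..<n} \<inter> {..<m}. \<bar>a k\<bar> powr s / S)"
          unfolding y_powr by (simp add: sum.inter_restrict)
        also have "\<dots> \<le> (\<Sum>k<m. \<bar>a k\<bar> powr s / S)"
          using S by (intro sum_mono2) auto
        also have "\<dots> = 1" using S by (simp add: S_def flip: sum_divide_distrib)
        finally show ?thesis .
      qed
      then have "y \<in> unit_ball p" using finite by (simp add: unit_ball_ennreal_iff)
      from le[OF this, of m] have "(\<Sum>k<m. a k * y k) \<le> M" .
      moreover have "a k * y k = \<bar>a k\<bar> powr s / S powr (1 / r)" if "k < m" for k
      proof -
        have "a k * y k = \<bar>a k\<bar> * \<bar>a k\<bar> powr (s - 1) / S powr (1 / r)"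
          using that by (simp add: y_def abs_sgn mult_ac)
        also have "\<bar>a k\<bar> * \<bar>a k\<bar> powr (s - 1) = \<bar>a k\<bar> powr s"
          using finite by (cases "a k = 0") (simp_all add: powr_diff)
        finally show ?thesis .
      qed
      ultimately have "S / S powr (1 / r) \<le> M"
        by (simp add: S_def sum_divide_distrib)
      also have "S / S powr (1 / r) = S powr (1 / s)"
      proof -
        have "1 / s = 1 - 1 / r" using finite by simp
        then show ?thesis using S by (simp add: powr_diff)
      qed
      finally have "(S powr (1 / s)) powr s \<le> M powr s" using finite by (intro powr_mono2) auto
      then show ?thesis using S finite by (simp add: powr_powr S_def)
    qed
    then show ?thesis using finite M by (simp add: lp_norm_ennreal_le_iff)
  qed
qed

section \<open>Vanishing of tails and of weighted remainders\<close>

text \<open>Density of the finitely supported sequences. It is confined to finite exponents; the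
  case \<infinity> goes through the gliding hump instead.\<close>

lemma lp_norm_tail_le:
  assumes r: "1 \<le> r" and y: "y \<in> lp (ennreal r)" and e: "0 < e"
  shows "\<exists>m0. \<forall>m\<ge>m0. lp_norm (ennreal r) (\<lambda>k. if k < m then 0 else y k) \<le> ennreal e"
proof -
  let ?g = "\<lambda>k. \<bar>y k\<bar> powr r"
  have sm: "summable ?g" using y lp_finite_iff[of "ennreal r" y] r by simp
  have "(\<lambda>m. \<Sum>k. ?g (k + m)) \<longlonglongrightarrow> 0" using sm by (rule suminf_exist_split2)
  moreover have "0 < e powr r" using e by simp
  ultimately have "\<forall>\<^sub>F m in sequentially. (\<Sum>k. ?g (k + m)) < e powr r" by (rule order_tendstoD)
  then obtain m0 where m0: "\<And>m. m \<ge> m0 \<Longrightarrow> (\<Sum>k. ?g (k + m)) < e powr r"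
    by (auto simp: eventually_sequentially)
  have "(\<Sum>k<n. \<bar>if k < m then 0 else y k\<bar> powr r) \<le> e powr r" if "m \<ge> m0" for m n
  proof -
    have "(\<Sum>k<n. \<bar>if k < m then 0 else y k\<bar> powr r) \<le> (\<Sum>k<n + m. \<bar>if k < m then 0 else y k\<bar> powr r)"
      by (intro sum_mono2) auto
    also have "\<dots> = (\<Sum>k<n. ?g (k + m))"
    proof -
      have "{..<n + m} = {..<m} \<union> {m..<n + m}" by auto
      then have "(\<Sum>k<n + m. \<bar>if k < m then 0 else y k\<bar> powr r) = (\<Sum>k=0 + m..<n + m. ?g k)"
        by (simp add: sum.union_disjoint Int_def)
      also have "\<dots> = (\<Sum>k<n. ?g (k + m))"
        by (simp only: sum.shift_bounds_nat_ivl lessThan_atLeast0)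
      finally show ?thesis .
    qed
    also have "\<dots> \<le> (\<Sum>k. ?g (k + m))"
      using sm by (intro sum_le_suminf) (auto intro: summable_ignore_initial_segment)
    also have "\<dots> \<le> e powr r" using m0[OF that] by simp
    finally show ?thesis .
  qed
  then show ?thesis using r e by (auto simp: lp_norm_ennreal_le_iff)
qed

text \<open>If \<open>r\<^sub>m \<Sum>\<^sub>k\<^sub><\<^sub>m \<bar>c\<^sub>k\<bar>\<close> had a nonzero limit, signs constant on sparse blocks and alternating from
  block to block would make \<open>r\<^sub>m \<Sum>\<^sub>k\<^sub><\<^sub>m c\<^sub>k y\<^sub>k\<close> oscillate.\<close>

lemma weighted_sums_tendsto_0:
  fixes r c :: "nat \<Rightarrow> real"
  assumes r: "r \<longlonglongrightarrow> 0"
    and conv: "\<And>y. (\<And>k. \<bar>y k\<bar> \<le> 1) \<Longrightarrow> convergent (\<lambda>m. r m * (\<Sum>k<m. c k * y k))"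
    and y: "Bseq y"
  shows "(\<lambda>m. r m * (\<Sum>k<m. c k * y k)) \<longlonglongrightarrow> 0"
proof -
  define C where "C m = (\<Sum>k<m. \<bar>c k\<bar>)" for m
  have C_nonneg: "0 \<le> C m" for m by (simp add: C_def sum_nonneg)
  have C_mono: "m \<le> n \<Longrightarrow> C m \<le> C n" for m n unfolding C_def by (intro sum_mono2) auto
  have s_le: "\<bar>\<Sum>k<m. c k * z k\<bar> \<le> K * C m" if "\<And>k. \<bar>z k\<bar> \<le> K" for z K m
  proof -
    have "\<bar>\<Sum>k<m. c k * z k\<bar> \<le> (\<Sum>k<m. \<bar>c k * z k\<bar>)" by (rule sum_abs)
    also have "\<dots> \<le> (\<Sum>k<m. K * \<bar>c k\<bar>)"
      using that by (intro sum_mono) (simp add: abs_mult mult.commute[of K] mult_left_mono)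
    finally show ?thesis by (simp add: C_def sum_distrib_left)
  qed
  \<comment> \<open>Testing with the signs of \<open>c\<close> gives a limit \<open>L\<close> for
    the absolute sums. These dominate the sums for every bounded \<open>y\<close> up to a constant,
    so it suffices that \<open>L = 0\<close>.\<close>
  have "convergent (\<lambda>m. r m * (\<Sum>k<m. c k * sgn (c k)))"
    by (rule conv) (simp add: abs_sgn_eq)
  then obtain L where L: "(\<lambda>m. r m * C m) \<longlonglongrightarrow> L"
    by (auto simp: convergent_def C_def abs_sgn)
  have "L = 0"
  proof (rule ccontr)
    assume "L \<noteq> 0"
    \<comment> \<open>For bounded \<open>C\<close> the factor \<open>r\<close> alone would force the
      limit 0.\<close>
    have unb: "\<exists>m. K < C m" for K
    proof (rule ccontr)
      assume "\<nexists>m. K < C m"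
      then have "(\<lambda>m. r m * C m) \<longlonglongrightarrow> 0"
        using C_nonneg \<open>\<nexists>m. K < C m\<close>
        by (intro tendsto_0_le[OF r, of _ K] always_eventually)
          (simp add: abs_mult not_less mult_left_mono)
      with L \<open>L \<noteq> 0\<close> LIMSEQ_unique show False by blast
    qed
    \<comment> \<open>Quadrupling lets each block dominate its past: the block contributes
      \<open>C (f (Suc j)) - C (f j)\<close> in absolute value, the past at most
      \<open>C (f j)\<close>, and the difference is at least
      \<open>C (f (Suc j)) / 2\<close>.\<close>
    have "\<exists>f. \<forall>n. 0 < C (f n) \<and> (f n < f (Suc n) \<and> 4 * C (f n) \<le> C (f (Suc n)))"
    proof (rule dependent_nat_choice)
      show "\<exists>x. 0 < C x" using unb by blast
      fix x n assume pos: "0 < C x"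
      obtain m where m: "4 * C x < C m" using unb by blast
      then have "x < m" using C_mono[of m x] pos by linarith
      with m pos show "\<exists>m. 0 < C m \<and> (x < m \<and> 4 * C x \<le> C m)"
        by (intro exI[of _ m] conjI) linarith+
    qed
    then obtain f where f_step: "\<And>n. f n < f (Suc n)" and f4: "\<And>n. 4 * C (f n) \<le> C (f (Suc n))"
      by blast
    have f: "strict_mono f" using f_step by (simp add: strict_mono_Suc_iff)
    \<comment> \<open>The \<open>LEAST\<close> term numbers the block containing \<open>k\<close>.
      It equals \<open>Suc j\<close> for \<open>f j \<le> k < f (Suc j)\<close>, whence the exponent
      in \<open>block\<close>.\<close>
    define z where "z k = sgn (c k) * (-1) ^ (LEAST j. k < f j)" for k
    have z1: "\<bar>z k\<bar> \<le> 1" for k by (simp add: z_def abs_mult abs_sgn_eq power_abs)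
    define s where "s m = (\<Sum>k<m. c k * z k)" for m
    have s_bound: "\<bar>s m\<bar> \<le> C m" for m unfolding s_def using s_le[of z 1 m] z1 by simp
    have block: "(-1) ^ Suc j * s (f (Suc j)) \<ge> C (f (Suc j)) / 2" for j
    proof -
      have least: "(LEAST i. k < f i) = Suc j" if "f j \<le> k" "k < f (Suc j)" for k
      proof (rule Least_equality)
        show "Suc j \<le> i" if "k < f i" for i
          using that \<open>f j \<le> k\<close> f by (metis Suc_leI leI le_less_trans not_less strict_mono_less_eq)
      qed (use that in auto)
      have split: "{..<f (Suc j)} = {..<f j} \<union> {f j..<f (Suc j)}" using f_step[of j] by auto
      have "s (f (Suc j)) = s (f j) + (\<Sum>k=f j..<f (Suc j). c k * z k)"
        unfolding s_def split by (rule sum.union_disjoint) auto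
      also have "(\<Sum>k=f j..<f (Suc j). c k * z k) = (\<Sum>k=f j..<f (Suc j). (-1) ^ Suc j * \<bar>c k\<bar>)"
        by (rule sum.cong) (auto simp: z_def least abs_sgn)
      also have "\<dots> = (-1) ^ Suc j * (\<Sum>k=f j..<f (Suc j). \<bar>c k\<bar>)"
        by (rule sum_distrib_left[symmetric])
      also have "(\<Sum>k=f j..<f (Suc j). \<bar>c k\<bar>) = C (f (Suc j)) - C (f j)"
        unfolding C_def split by (subst sum.union_disjoint) auto
      finally have "s (f (Suc j)) = s (f j) + (-1) ^ Suc j * (C (f (Suc j)) - C (f j))" .
      moreover have "(-1) ^ Suc j * ((-1) ^ Suc j * t) = t" for t :: real
        by (simp flip: mult.assoc power_mult_distrib)
      ultimately have "(-1) ^ Suc j * s (f (Suc j)) = (-1) ^ Suc j * s (f j) + (C (f (Suc j)) - C (f j))"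
        by (simp only: ring_distribs)
      moreover have "\<bar>(-1) ^ Suc j * s (f j)\<bar> \<le> C (f j)"
        using s_bound by (simp add: abs_mult power_abs)
      ultimately show ?thesis using f4[of j] C_nonneg[of "f j"] by linarith
    qed
    obtain T where T: "(\<lambda>m. r m * s m) \<longlonglongrightarrow> T"
      using conv[of z, OF z1] by (auto simp: convergent_def s_def)
    \<comment> \<open>The sign of \<open>r m\<close> is unknown. Multiplying by
      \<open>r m * C m\<close>, whose limit is known, produces the nonnegative factor
      \<open>(r m)\<^sup>2\<close>, so that \<open>block\<close> can be used.\<close>
    have "(\<lambda>m. (r m * s m) * (r m * C m)) \<longlonglongrightarrow> T * L" by (rule tendsto_mult[OF T L])
    then have TL: "((\<lambda>m. (r m * s m) * (r m * C m)) \<circ> (f \<circ> g)) \<longlonglongrightarrow> T * L"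
      if "strict_mono g" for g
      using that f by (intro LIMSEQ_subseq_LIMSEQ strict_mono_o)
    have "(\<lambda>m. (r m * C m) * (r m * C m) / 2) \<longlonglongrightarrow> L * L / 2"
      by (intro tendsto_divide tendsto_mult L tendsto_const) simp
    then have LL: "((\<lambda>m. (r m * C m) * (r m * C m) / 2) \<circ> (f \<circ> g)) \<longlonglongrightarrow> L * L / 2"
      if "strict_mono g" for g
      using that f by (intro LIMSEQ_subseq_LIMSEQ strict_mono_o)
    have key: "(r m * C m) * (r m * C m) / 2 \<le> e * ((r m * s m) * (r m * C m))"
      if "C m / 2 \<le> e * s m" for m e
    proof -
      have "(r m)\<^sup>2 * C m * (C m / 2) \<le> (r m)\<^sup>2 * C m * (e * s m)"
        using that C_nonneg by (intro mult_left_mono) auto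
      then show ?thesis by (simp add: power2_eq_square mult_ac)
    qed
    \<comment> \<open>Along even block ends the limit satisfies
      \<open>T * L \<ge> L * L / 2\<close>, along odd ones \<open>T * L \<le> - (L * L / 2)\<close>;
      together they contradict \<open>L \<noteq> 0\<close>.\<close>
    have "L * L / 2 \<le> T * L"
    proof (rule LIMSEQ_le[OF LL TL])
      show "strict_mono (\<lambda>i::nat. Suc (Suc (2 * i)))" by (simp add: strict_mono_def)
      then show "strict_mono (\<lambda>i::nat. Suc (Suc (2 * i)))" .
      show "\<exists>N. \<forall>n\<ge>N. ((\<lambda>m. (r m * C m) * (r m * C m) / 2) \<circ> (f \<circ> (\<lambda>i. Suc (Suc (2 * i))))) n
          \<le> ((\<lambda>m. (r m * s m) * (r m * C m)) \<circ> (f \<circ> (\<lambda>i. Suc (Suc (2 * i))))) n"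
        using key[of "f (Suc (Suc (2 * i)))" 1 for i] block[of "Suc (2 * i)" for i] by auto
    qed
    moreover have "L * L / 2 \<le> - (T * L)"
    proof (rule LIMSEQ_le[OF LL tendsto_minus[OF TL]])
      show "strict_mono (\<lambda>i::nat. Suc (2 * i))" by (simp add: strict_mono_def)
      then show "strict_mono (\<lambda>i::nat. Suc (2 * i))" .
      show "\<exists>N. \<forall>n\<ge>N. ((\<lambda>m. (r m * C m) * (r m * C m) / 2) \<circ> (f \<circ> (\<lambda>i. Suc (2 * i)))) n
          \<le> - ((\<lambda>m. (r m * s m) * (r m * C m)) \<circ> (f \<circ> (\<lambda>i. Suc (2 * i)))) n"
        using key[of "f (Suc (2 * i))" "-1" for i] block[of "2 * i" for i] by auto
    qed
    ultimately have "L * L \<le> 0" by linarith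
    with \<open>L \<noteq> 0\<close> show False by (auto simp: mult_le_0_iff)
  qed
  obtain K where "\<forall>k. norm (y k) \<le> K" using y by (rule BseqE)
  then have K: "\<bar>y k\<bar> \<le> K" for k by simp
  show ?thesis
  proof (rule Lim_null_comparison)
    have "\<bar>r m * (\<Sum>k<m. c k * y k)\<bar> \<le> K * \<bar>r m * C m\<bar>" for m
    proof -
      have "\<bar>r m\<bar> * \<bar>\<Sum>k<m. c k * y k\<bar> \<le> \<bar>r m\<bar> * (K * C m)"
        using s_le[OF K] by (intro mult_left_mono) auto
      then show ?thesis using C_nonneg[of m] by (simp add: abs_mult mult_ac)
    qed
    then show "\<forall>\<^sub>F m in sequentially. norm (r m * (\<Sum>k<m. c k * y k)) \<le> K * \<bar>r m * C m\<bar>"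
      by simp
    show "(\<lambda>m. K * \<bar>r m * C m\<bar>) \<longlonglongrightarrow> 0"
      using L \<open>L = 0\<close> by (intro tendsto_mult_right_zero tendsto_rabs_zero) simp
  qed
qed

section \<open>The transform E and its inverse\<close>

lemma fibo_pos: "0 < fibo k"
  by (simp add: fibo_def fib_neq_0_nat)

lemma prev_Suc [simp]: "prev x (Suc k) = x k"
  by (simp add: prev_def)

lemma prev_0 [simp]: "prev x 0 = 0"
  by (simp add: prev_def)

definition fib_weight :: "(nat \<Rightarrow> real) \<Rightarrow> nat \<Rightarrow> real" where
  "fib_weight lam k = 1 / ((lam k - prev lam k) * fibo k * fibo (k+1))"

definition weight_diff :: "(nat \<Rightarrow> real) \<Rightarrow> nat \<Rightarrow> real" where
  "weight_diff lam k = lam k * (fib_weight lam k - fib_weight lam (k+1))"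

text \<open>With \<open>x k = (fibo (k+1))\<^sup>2 * u k\<close>, the equation
  \<open>E_map lam x = y\<close> says that \<open>u k\<close> exceeds its predecessor by
  \<open>fib_weight lam k\<close> times the increment of \<open>lam k * y k\<close>. Summing these
  increments by parts produces the coefficients \<open>weight_diff\<close>.\<close>

definition E_inv :: "(nat \<Rightarrow> real) \<Rightarrow> (nat \<Rightarrow> real) \<Rightarrow> nat \<Rightarrow> real" where
  "E_inv lam y k =
     (fibo (k+1))\<^sup>2 * (lam k * fib_weight lam k * y k + (\<Sum>j<k. weight_diff lam j * y j))"

lemma a_hat_eq:
  "a_hat lam A n k = lam k * fib_weight lam k * ((fibo (k+1))\<^sup>2 * A n k)
     + weight_diff lam k * (\<Sum>i. (fibo ((k+1+i) + 1))\<^sup>2 * A n (k+1+i))"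
  by (simp add: a_hat_def fib_weight_def weight_diff_def algebra_simps add_divide_distrib)

lemma E_inv_comb:
  "E_inv lam (\<lambda>k. a * x k + b * y k) k = a * E_inv lam x k + b * E_inv lam y k"
  by (simp add: E_inv_def algebra_simps sum.distrib sum_distrib_left)

context
  fixes lam :: "nat \<Rightarrow> real"
  assumes lam_pos: "\<And>k. 0 < lam k" and lam_mono: "strict_mono lam"
begin

lemma lam_diff_pos: "0 < lam k - prev lam k"
  using lam_pos lam_mono by (cases k) (auto simp: strict_mono_Suc_iff)

lemma E_map_E_inv: "E_map lam (E_inv lam y) = y"
proof
  fix n
  have "(\<Sum>k=0..n. (lam k - prev lam k) * (fibo k / fibo (k+1) * E_inv lam y k
      - fibo (k+1) / fibo k * prev (E_inv lam y) k)) = lam n * y n"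
  proof (induction n)
    case 0
    show ?case
      using fibo_pos[of 0] fibo_pos[of 1] lam_pos[of 0]
      by (simp add: E_inv_def fib_weight_def power2_eq_square)
  next
    case (Suc n)
    let ?F = "fibo (Suc n)" and ?G = "fibo (Suc (Suc n))" and ?D = "lam (Suc n) - lam n"
    \<comment> \<open>Removing the squared Fibonacci factor turns the two-term expression in
      \<open>E_map\<close> into \<open>?F * ?G * (u (Suc n) - u n)\<close>, and the sum
      telescopes.\<close>
    define u where "u k = lam k * fib_weight lam k * y k + (\<Sum>j<k. weight_diff lam j * y j)" for k
    have x: "E_inv lam y k = (fibo (Suc k))\<^sup>2 * u k" for k by (simp add: E_inv_def u_def)
    have D: "?D \<noteq> 0" using lam_diff_pos[of "Suc n"] by simp
    have F: "?F \<noteq> 0" "?G \<noteq> 0" using fibo_pos less_irrefl by metis+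
    have "u (Suc n) - u n = fib_weight lam (Suc n) * (lam (Suc n) * y (Suc n) - lam n * y n)"
      by (simp add: u_def weight_diff_def algebra_simps)
    moreover have "?D * ?F * ?G * fib_weight lam (Suc n) = 1"
      using D F by (simp add: fib_weight_def)
    ultimately have "?D * ?F * ?G * (u (Suc n) - u n) = lam (Suc n) * y (Suc n) - lam n * y n"
      by (metis mult.assoc mult_1)
    moreover have "?D * (?F / ?G * E_inv lam y (Suc n) - ?G / ?F * E_inv lam y n)
        = ?D * ?F * ?G * (u (Suc n) - u n)"
      using F by (simp add: x power2_eq_square algebra_simps)
    ultimately show ?case using Suc by simp
  qed
  then show "E_map lam (E_inv lam y) n = y n"
    using lam_pos[of n] by (simp add: E_map_def)
qed

text \<open>The transform is triangular with nonzero diagonal: differences of consecutive partial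
  sums recover the entries one by one.\<close>

lemma E_map_inject:
  assumes "E_map lam x = E_map lam x'"
  shows "x = x'"
proof
  let ?t = "\<lambda>x k. (lam k - prev lam k) * (fibo k / fibo (k+1) * x k - fibo (k+1) / fibo k * prev x k)"
  have sums: "(\<Sum>k=0..n. ?t x k) = (\<Sum>k=0..n. ?t x' k)" for n
    using fun_cong[OF assms, of n] lam_pos[of n] by (simp add: E_map_def)
  fix n
  show "x n = x' n"
  proof (induction n rule: less_induct)
    case (less n)
    have pr: "prev x n = prev x' n" using less by (cases n) auto
    have "?t x n = ?t x' n"
      using sums[of n] sums[of "n - 1"] by (cases n) auto
    then have "fibo n / fibo (n+1) * x n = fibo n / fibo (n+1) * x' n"
      using lam_diff_pos[of n] pr by simp
    then show ?case using fibo_pos[of n] fibo_pos[of "n+1"] by simp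
  qed
qed

lemma E_inv_E_map: "E_inv lam (E_map lam x) = x"
  by (rule E_map_inject) (rule E_map_E_inv)

text \<open>The parameter \<open>\<beta>\<close> is free. With \<open>\<beta> = suminf b\<close> the
  coefficients form a row of \<open>a_hat\<close> and the factor of the remainder tends to 0;
  \<open>\<beta> = 0\<close> serves when \<open>b\<close> is not summable.\<close>

lemma sum_mult_E_inv:
  fixes a y :: "nat \<Rightarrow> real" and \<beta> :: real
  defines "b \<equiv> \<lambda>k. (fibo (k+1))\<^sup>2 * a k"
  shows "(\<Sum>k<m. a k * E_inv lam y k)
    = (\<Sum>k<m. (lam k * fib_weight lam k * b k + weight_diff lam k * (\<beta> - (\<Sum>j<Suc k. b j))) * y k)
      + ((\<Sum>k<m. b k) - \<beta>) * (\<Sum>k<m. weight_diff lam k * y k)"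
proof (induction m)
  case (Suc m)
  have "a m * E_inv lam y m = b m * (lam m * fib_weight lam m * y m + (\<Sum>j<m. weight_diff lam j * y j))"
    by (simp add: E_inv_def b_def)
  then show ?case using Suc by (simp add: algebra_simps)
qed simp

text \<open>The bound is independent of \<open>y\<close>, so each finite section of a row is bounded
  on the unit ball.\<close>

lemma abs_E_inv_le:
  assumes "\<And>k. \<bar>y k\<bar> \<le> 1"
  shows "\<bar>E_inv lam y k\<bar>
    \<le> (fibo (k+1))\<^sup>2 * (\<bar>lam k * fib_weight lam k\<bar> + (\<Sum>j<k. \<bar>weight_diff lam j\<bar>))"
proof -
  have "\<bar>\<Sum>j<k. weight_diff lam j * y j\<bar> \<le> (\<Sum>j<k. \<bar>weight_diff lam j * y j\<bar>)" by (rule sum_abs)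
  also have "\<dots> \<le> (\<Sum>j<k. \<bar>weight_diff lam j\<bar>)"
    using assms by (intro sum_mono) (simp add: abs_mult mult_left_le)
  finally have s: "\<bar>\<Sum>j<k. weight_diff lam j * y j\<bar> \<le> (\<Sum>j<k. \<bar>weight_diff lam j\<bar>)" .
  have "\<bar>lam k * fib_weight lam k * y k\<bar> \<le> \<bar>lam k * fib_weight lam k\<bar>"
    using assms[of k] by (simp add: abs_mult mult_left_le)
  with s have "\<bar>lam k * fib_weight lam k * y k + (\<Sum>j<k. weight_diff lam j * y j)\<bar>
      \<le> \<bar>lam k * fib_weight lam k\<bar> + (\<Sum>j<k. \<bar>weight_diff lam j\<bar>)"
    by linarith
  from mult_left_mono[OF this, of "(fibo (k+1))\<^sup>2"] show ?thesis
    unfolding E_inv_def by (subst abs_mult) simp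
qed

section \<open>Representation of a single row by its transformed coefficients\<close>

context
  fixes p :: ennreal and A :: "nat \<Rightarrow> nat \<Rightarrow> real" and n :: nat
  assumes p: "1 \<le> p"
    and summ: "\<And>y. y \<in> lp p \<Longrightarrow> summable (\<lambda>k. A n k * E_inv lam y k)"
begin

interpretation seq_unit_ball "unit_ball p"
  rewrites "seq_unit_ball.space (unit_ball p) = lp p"
  using p by (simp_all add: seq_unit_ball_unit_ball space_unit_ball)

lemma linear_functional_row: "linear_functional (\<lambda>y. mat_map A (E_inv lam y) n)"
  unfolding linear_functional_def
proof (intro ballI allI)
  fix x y a b assume xy: "x \<in> lp p" "y \<in> lp p"
  have "(\<lambda>k. a * (A n k * E_inv lam x k) + b * (A n k * E_inv lam y k)) sums
      (a * mat_map A (E_inv lam x) n + b * mat_map A (E_inv lam y) n)"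
    unfolding mat_map_def by (intro sums_add sums_mult summable_sums summ xy)
  then show "mat_map A (E_inv lam (\<lambda>k. a * x k + b * y k)) n
      = a * mat_map A (E_inv lam x) n + b * mat_map A (E_inv lam y) n"
    unfolding mat_map_def E_inv_comb by (simp add: algebra_simps sums_iff)
qed

text \<open>Uniform boundedness is applied to the partial sums of the row; they are pointwise
  bounded because they converge, and the bound survives the limit.\<close>

lemma row_bounded: "\<exists>C. \<forall>y\<in>unit_ball p. \<bar>mat_map A (E_inv lam y) n\<bar> \<le> C"
proof -
  have "\<exists>C. \<forall>m. \<forall>y\<in>unit_ball p. \<bar>\<Sum>k<m. A n k * E_inv lam y k\<bar> \<le> C"
  proof (rule uniform_boundedness)
    fix m
    show "linear_functional (\<lambda>y. \<Sum>k<m. A n k * E_inv lam y k)"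
      by (simp add: linear_functional_def E_inv_comb algebra_simps sum.distrib sum_distrib_left)
    have "\<bar>\<Sum>k<m. A n k * E_inv lam y k\<bar>
        \<le> (\<Sum>k<m. \<bar>A n k\<bar> * ((fibo (k+1))\<^sup>2 * (\<bar>lam k * fib_weight lam k\<bar> + (\<Sum>j<k. \<bar>weight_diff lam j\<bar>))))"
      if "y \<in> unit_ball p" for y
      using abs_E_inv_le[of y] abs_le_one[OF that]
      by (intro order_trans[OF sum_abs] sum_mono) (simp add: abs_mult mult_left_mono)
    then show "\<exists>C. \<forall>y\<in>unit_ball p. \<bar>\<Sum>k<m. A n k * E_inv lam y k\<bar> \<le> C" by blast
  next
    fix y assume "y \<in> lp p"
    then have "Bseq (\<lambda>m. \<Sum>k<m. A n k * E_inv lam y k)"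
      using summ by (intro convergent_imp_Bseq) (simp add: summable_iff_convergent)
    then show "\<exists>K. \<forall>m. \<bar>\<Sum>k<m. A n k * E_inv lam y k\<bar> \<le> K" by (auto simp: Bseq_def)
  qed
  then obtain C where C: "\<And>m y. y \<in> unit_ball p \<Longrightarrow> \<bar>\<Sum>k<m. A n k * E_inv lam y k\<bar> \<le> C" by blast
  have "\<bar>mat_map A (E_inv lam y) n\<bar> \<le> C" if y: "y \<in> unit_ball p" for y
    unfolding mat_map_def
    using tendsto_rabs[OF summable_LIMSEQ[OF summ[OF mem_space[OF y]]]] C[OF y]
    by (intro LIMSEQ_le_const2) auto
  then show ?thesis by blast
qed

text \<open>If the series in \<open>a_hat\<close> converges, \<open>r\<close> is minus its tail. If
  it diverges, testing with unit vectors forces every \<open>weight_diff\<close> to vanish, and so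
  does the remainder.\<close>

lemma row_summation_by_parts:
  obtains r where "r \<longlonglongrightarrow> 0"
    and "\<And>m y. (\<Sum>k<m. A n k * E_inv lam y k)
      = (\<Sum>k<m. a_hat lam A n k * y k) + r m * (\<Sum>k<m. weight_diff lam k * y k)"
proof (cases "summable (\<lambda>k. (fibo (k+1))\<^sup>2 * A n k)")
  case True
  define b where "b k = (fibo (k+1))\<^sup>2 * A n k" for k
  have sb: "summable b" using True by (simp add: b_def[abs_def])
  define r where "r m = (\<Sum>k<m. b k) - suminf b" for m
  have "r \<longlonglongrightarrow> 0"
    using summable_LIMSEQ[OF sb] unfolding r_def by (simp add: LIM_zero_iff)
  moreover have hat: "a_hat lam A n k = lam k * fib_weight lam k * b k
      + weight_diff lam k * (suminf b - (\<Sum>j<Suc k. b j))" for k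
  proof -
    have "(\<Sum>i. b (i + Suc k)) = suminf b - (\<Sum>j<Suc k. b j)"
      using suminf_split_initial_segment[OF sb, of "Suc k"] by simp
    then show ?thesis unfolding a_hat_eq by (simp add: b_def add_ac)
  qed
  ultimately show ?thesis
    using sum_mult_E_inv[of "A n" _ _ "suminf b"] by (intro that[of r]) (auto simp: hat r_def b_def)
next
  case False
  have "weight_diff lam j = 0" for j
  proof (rule ccontr)
    assume j: "weight_diff lam j \<noteq> 0"
    \<comment> \<open>Beyond position \<open>j\<close>, \<open>E_inv\<close> of this unit vector is
      \<open>weight_diff lam j\<close> times the squared Fibonacci numbers, so summability of the
      row would transfer to the divergent series.\<close>
    define e :: "nat \<Rightarrow> real" where "e k = (if k = j then 1 else 0)" for k
    have "summable (\<lambda>k. A n k * E_inv lam e k)"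
      using unit_vector_mem_unit_ball[OF p, of j] by (intro summ mem_space) (simp add: e_def[abs_def])
    moreover have "A n k * E_inv lam e k = weight_diff lam j * ((fibo (k+1))\<^sup>2 * A n k)" if "k > j" for k
      using that by (simp add: E_inv_def e_def if_distrib cong: if_cong)
    then have "\<forall>\<^sub>F k in sequentially. A n k * E_inv lam e k = weight_diff lam j * ((fibo (k+1))\<^sup>2 * A n k)"
      by (intro eventually_sequentiallyI[of "Suc j"]) auto
    ultimately have "summable (\<lambda>k. weight_diff lam j * ((fibo (k+1))\<^sup>2 * A n k))"
      using summable_cong by fastforce
    then show False using j False by (simp add: summable_cmult_iff)
  qed
  \<comment> \<open>Here \<open>a_hat\<close> contains the unspecified \<open>suminf\<close> of a
    divergent series, but multiplied by 0.\<close>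
  then show ?thesis
    using sum_mult_E_inv[of "A n" _ _ 0] by (intro that[of "\<lambda>_. 0"]) (auto simp: a_hat_eq)
qed

text \<open>Beyond the support both sums are frozen and only the factor \<open>r\<close> still
  varies, tending to 0.\<close>

lemma row_finite_support:
  assumes y: "y \<in> lp p" and supp: "\<And>k. m \<le> k \<Longrightarrow> y k = 0"
  shows "mat_map A (E_inv lam y) n = (\<Sum>k<m. a_hat lam A n k * y k)"
proof -
  obtain r where r: "r \<longlonglongrightarrow> 0"
    and eq: "\<And>m y. (\<Sum>k<m. A n k * E_inv lam y k)
      = (\<Sum>k<m. a_hat lam A n k * y k) + r m * (\<Sum>k<m. weight_diff lam k * y k)"
    using row_summation_by_parts by blast
  have cut: "(\<Sum>k<i. g k * y k) = (\<Sum>k<m. g k * y k)" if "m \<le> i" for i and g :: "nat \<Rightarrow> real"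
    using that supp by (intro sum.mono_neutral_right) auto
  have "(\<lambda>i. (\<Sum>k<m. a_hat lam A n k * y k) + r i * (\<Sum>k<m. weight_diff lam k * y k))
      \<longlonglongrightarrow> (\<Sum>k<m. a_hat lam A n k * y k) + 0 * (\<Sum>k<m. weight_diff lam k * y k)"
    by (intro tendsto_intros r)
  moreover have "\<forall>\<^sub>F i in sequentially. (\<Sum>k<m. a_hat lam A n k * y k)
      + r i * (\<Sum>k<m. weight_diff lam k * y k) = (\<Sum>k<i. A n k * E_inv lam y k)"
  proof (rule eventually_sequentiallyI)
    show "(\<Sum>k<m. a_hat lam A n k * y k) + r i * (\<Sum>k<m. weight_diff lam k * y k)
        = (\<Sum>k<i. A n k * E_inv lam y k)" if "m \<le> i" for i
      by (simp only: eq cut[OF that])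
  qed
  ultimately have "(\<lambda>i. \<Sum>k<i. A n k * E_inv lam y k) \<longlonglongrightarrow>
      (\<Sum>k<m. a_hat lam A n k * y k) + 0 * (\<Sum>k<m. weight_diff lam k * y k)"
    by (rule Lim_transform_eventually)
  then have "(\<lambda>i. \<Sum>k<i. A n k * E_inv lam y k) \<longlonglongrightarrow> (\<Sum>k<m. a_hat lam A n k * y k)"
    by simp
  then show ?thesis
    unfolding mat_map_def using summable_LIMSEQ[OF summ[OF y]] LIMSEQ_unique by blast
qed

text \<open>For finite exponents the truncations of \<open>y\<close> converge in norm and the row is
  continuous. In the case \<infinity> truncations need not converge, so the remainder itself is
  shown to vanish by \<open>weighted_sums_tendsto_0\<close>.\<close>

lemma row_sums:
  assumes y: "y \<in> lp p"
  shows "(\<lambda>k. a_hat lam A n k * y k) sums mat_map A (E_inv lam y) n"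
proof -
  let ?L = "\<lambda>y. mat_map A (E_inv lam y) n" and ?a = "a_hat lam A n"
  have lin: "?L (\<lambda>k. a * x k + b * y k) = a * ?L x + b * ?L y" if "x \<in> lp p" "y \<in> lp p" for x y a b
    using linear_functional_row that unfolding linear_functional_def by blast
  obtain C where C: "\<And>y. y \<in> unit_ball p \<Longrightarrow> \<bar>?L y\<bar> \<le> C" using row_bounded by blast
  have C0: "0 \<le> C" using C[OF zero_mem] by linarith
  have trunc: "?L (\<lambda>k. if k < m then y k else 0) = (\<Sum>k<m. ?a k * y k)"
    if "(\<lambda>k. if k < m then y k else 0) \<in> lp p" for m y
    using row_finite_support[OF that, of m] by simp
  have scaled: "\<bar>?L z\<bar> \<le> C * e" if e: "0 < e" and z: "lp_norm p z \<le> ennreal e" for z e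
  proof -
    define u where "u k = z k / e" for k
    have zu: "z = (\<lambda>k. e * u k)" using e by (auto simp: u_def)
    have "lp_norm p u \<le> ennreal 1"
      using z lp_norm_scale_le_iff[OF p e, of 1 u] by (simp add: zu)
    then have u: "u \<in> unit_ball p" by (simp add: unit_ball_def)
    have "?L (\<lambda>k. e * u k + 0 * u k) = e * ?L u + 0 * ?L u"
      by (intro lin mem_space u)
    then have "?L z = e * ?L u" by (simp add: zu)
    then show ?thesis using C[OF u] e by (simp add: abs_mult mult.commute)
  qed
  show ?thesis
    using p
  proof (cases p rule: exponent_cases)
    case infinite
    have le1: "y \<in> lp p" if "\<And>k. \<bar>y k\<bar> \<le> 1" for y
      using that infinite by (intro mem_space) (simp add: unit_ball_infinity_iff)
    \<comment> \<open>Truncated signs are admissible test vectors, so the row of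
      \<open>a_hat\<close> is absolutely summable. The remainder is then a difference of convergent
      sequences for every bounded argument, as the gliding hump requires.\<close>
    have "(\<Sum>k<m. \<bar>?a k\<bar>) \<le> C" for m
    proof -
      let ?y = "\<lambda>k. if k < m then sgn (?a k) else 0"
      have "?y \<in> unit_ball p" using infinite by (simp add: unit_ball_infinity_iff abs_sgn_eq)
      then have "?L ?y \<le> C" using C by fastforce
      moreover have "?L ?y = (\<Sum>k<m. \<bar>?a k\<bar>)"
        using trunc[OF mem_space[OF \<open>?y \<in> unit_ball p\<close>]] by (simp add: abs_sgn)
      ultimately show ?thesis by simp
    qed
    then have abs_summable: "summable (\<lambda>k. \<bar>?a k\<bar>)"
      by (intro bounded_imp_summable[of _ C]) (simp_all only: abs_ge_zero flip: lessThan_Suc_atMost)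
    have summ_hat: "summable (\<lambda>k. ?a k * y k)" if bs: "Bseq y" for y
    proof -
      obtain K where "\<forall>k. norm (y k) \<le> K" using bs by (rule BseqE)
      then have K: "\<bar>y k\<bar> \<le> K" for k by simp
      have "summable (\<lambda>k. \<bar>?a k\<bar> * K)" by (rule summable_mult2[OF abs_summable])
      then show ?thesis
        by (rule summable_comparison_test') (simp add: abs_mult K mult_left_mono)
    qed
    obtain r where r: "r \<longlonglongrightarrow> 0"
      and eq: "\<And>m y. (\<Sum>k<m. A n k * E_inv lam y k)
        = (\<Sum>k<m. ?a k * y k) + r m * (\<Sum>k<m. weight_diff lam k * y k)"
      using row_summation_by_parts by blast
    have rem: "(\<lambda>m. r m * (\<Sum>k<m. weight_diff lam k * y k)) = (\<lambda>m. (\<Sum>k<m. A n k * E_inv lam y k) - (\<Sum>k<m. ?a k * y k))" for y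
      by (simp add: eq)
    have "(\<lambda>m. r m * (\<Sum>k<m. weight_diff lam k * y k)) \<longlonglongrightarrow> 0"
    proof (rule weighted_sums_tendsto_0[OF r])
      show "Bseq y" using y infinite lp_infinity_iff by simp
      fix z :: "nat \<Rightarrow> real" assume z: "\<And>k. \<bar>z k\<bar> \<le> 1"
      then have "Bseq z" by (intro BseqI'[of _ 1]) auto
      then show "convergent (\<lambda>m. r m * (\<Sum>k<m. weight_diff lam k * z k))"
        unfolding rem using summ[OF le1[OF z]] summ_hat
        by (intro convergent_diff) (simp_all add: summable_iff_convergent)
    qed
    then have "(\<lambda>m. (\<Sum>k<m. A n k * E_inv lam y k) - r m * (\<Sum>k<m. weight_diff lam k * y k)) \<longlonglongrightarrow> ?L y - 0"
      unfolding mat_map_def by (intro tendsto_diff summable_LIMSEQ summ y)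
    then show ?thesis by (simp add: sums_def eq)
  next
    case (finite r)
    show ?thesis
      unfolding sums_def
    proof (rule LIMSEQ_I)
      fix \<epsilon> :: real assume "0 < \<epsilon>"
      \<comment> \<open>The divisor \<open>C + 1\<close> also covers \<open>C = 0\<close>.\<close>
      define e where "e = \<epsilon> / (C + 1)"
      have e: "0 < e" "C * e < \<epsilon>" using \<open>0 < \<epsilon>\<close> C0 by (auto simp: e_def field_simps)
      obtain m0 where m0: "\<And>m. m0 \<le> m \<Longrightarrow> lp_norm p (\<lambda>k. if k < m then 0 else y k) \<le> ennreal e"
        using lp_norm_tail_le[of r y e] finite y e by blast
      have "norm ((\<Sum>k<m. ?a k * y k) - ?L y) < \<epsilon>" if "m0 \<le> m" for m
      proof -
        let ?t = "\<lambda>k. if k < m then 0 else y k" and ?h = "\<lambda>k. if k < m then y k else 0"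
        have t: "?t \<in> lp p"
          using m0[OF that] by (auto simp: lp_def intro: order_le_less_trans)
        have h: "?h = (\<lambda>k. 1 * y k + (-1) * ?t k)" by auto
        have "?h \<in> lp p" unfolding h by (rule space_comb[OF y t])
        then have "(\<Sum>k<m. ?a k * y k) = ?L ?h" by (rule trunc[symmetric])
        also have "\<dots> = 1 * ?L y + (-1) * ?L ?t"
          unfolding h by (rule lin[OF y t])
        finally have "norm ((\<Sum>k<m. ?a k * y k) - ?L y) = \<bar>?L ?t\<bar>" by simp
        also have "\<dots> \<le> C * e" by (rule scaled[OF e(1) m0[OF that]])
        finally show ?thesis using e by simp
      qed
      then show "\<exists>m0. \<forall>m\<ge>m0. norm ((\<Sum>k<m. ?a k * y k) - ?L y) < \<epsilon>" by blast
    qed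
  qed
qed

end

end

section \<open>Matrix norms as suprema of dual norms\<close>

text \<open>The upper bound is Hoelder's inequality in the limit. For the lower one, truncations
  stay in the ball, so partial sums are themselves values of \<open>L\<close> and
  \<open>lp_norm_le_dual\<close> applies.\<close>

lemma SUP_unit_ball_functional:
  assumes p: "1 \<le> p" and pq: "1 / p + 1 / q = 1"
    and sums: "\<And>y. y \<in> unit_ball p \<Longrightarrow> (\<lambda>k. a k * y k) sums L y"
  shows "(SUP y\<in>unit_ball p. ennreal \<bar>L y\<bar>) = lp_norm q a"
proof (rule antisym)
  show "(SUP y\<in>unit_ball p. ennreal \<bar>L y\<bar>) \<le> lp_norm q a"
  proof (rule SUP_least)
    fix y assume y: "y \<in> unit_ball p"
    show "ennreal \<bar>L y\<bar> \<le> lp_norm q a"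
    proof (cases "lp_norm q a")
      case (real M)
      have "\<bar>\<Sum>k<m. a k * y k\<bar> \<le> M" for m
        by (rule order_trans[OF sum_abs Holder_unit_ball[OF p pq real(1) _ y]]) (simp add: real)
      moreover have "(\<lambda>m. \<bar>\<Sum>k<m. a k * y k\<bar>) \<longlonglongrightarrow> \<bar>L y\<bar>"
        using sums[OF y] unfolding sums_def by (rule tendsto_rabs)
      ultimately have "\<bar>L y\<bar> \<le> M" by (intro LIMSEQ_le_const2) auto
      then show ?thesis using real by (auto intro: ennreal_leI)
    qed auto
  qed
next
  show "lp_norm q a \<le> (SUP y\<in>unit_ball p. ennreal \<bar>L y\<bar>)"
  proof (cases "SUP y\<in>unit_ball p. ennreal \<bar>L y\<bar>")
    case (real M)
    have bound: "\<bar>L y\<bar> \<le> M" if "y \<in> unit_ball p" for y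
    proof -
      have "ennreal \<bar>L y\<bar> \<le> ennreal M" unfolding real(2)[symmetric] using that by (rule SUP_upper)
      then show ?thesis using real(1) by simp
    qed
    have "(\<Sum>k<m. a k * y k) \<le> M" if y: "y \<in> unit_ball p" for m y
    proof -
      let ?h = "\<lambda>k. if k < m then y k else 0"
      have h: "?h \<in> unit_ball p" by (rule unit_ball_mono[OF p y]) auto
      have "(\<lambda>k. a k * ?h k) sums (\<Sum>k<m. a k * ?h k)" by (rule sums_finite) auto
      then have "L ?h = (\<Sum>k<m. a k * ?h k)" using sums[OF h] sums_unique2 by blast
      then show ?thesis using bound[OF h] by simp
    qed
    from lp_norm_le_dual[OF p pq this] show ?thesis using real by simp
  qed (simp only: top_greatest)
qed

text \<open>Unifies the three formulas, so that duality treats all exponents at once; for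
  \<open>p = 1\<close> the two suprema are exchanged.\<close>

lemma mat_norm_linf_eq:
  assumes p: "1 \<le> p" and pq: "1 / p + 1 / q = 1"
  shows "mat_norm_linf lam p q A = (SUP n. lp_norm q (a_hat lam A n))"
  using p pq
proof (cases rule: conjugate_exponent_cases)
  case one
  then have "mat_norm_linf lam p q A = (SUP k. SUP n. ennreal \<bar>a_hat lam A n k\<bar>)"
    by (simp add: mat_norm_linf_def)
  also have "\<dots> = (SUP n. SUP k. ennreal \<bar>a_hat lam A n k\<bar>)" by (rule SUP_commute)
  also have "\<dots> = (SUP n. lp_norm q (a_hat lam A n))" using one by (simp add: lp_norm_def)
  finally show ?thesis .
next
  case infinite
  then show ?thesis by (simp only: mat_norm_linf_def lp_norm_one infinity_ennreal_def simp_thms if_True)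
next
  case (finite r s)
  then have "p \<noteq> top" "p \<noteq> 1" "q \<noteq> top" by simp_all
  then show ?thesis
    by (simp only: mat_norm_linf_def lp_norm_def infinity_ennreal_def simp_thms if_False)
qed

text \<open>For \<open>p = 1\<close> the norm is a supremum of column sums instead, which
  \<open>op_norm_l1_eq\<close> handles separately.\<close>

lemma mat_norm_l1_eq:
  assumes p: "1 \<le> p" and pq: "1 / p + 1 / q = 1" and p1: "p \<noteq> 1"
  shows "mat_norm_l1 lam p q A = (SUP N\<in>{N. finite N}. lp_norm q (\<lambda>k. \<Sum>n\<in>N. a_hat lam A n k))"
  using p pq
proof (cases rule: conjugate_exponent_cases)
  case one
  with p1 show ?thesis by simp
next
  case infinite
  then show ?thesis by (simp only: mat_norm_l1_def lp_norm_one infinity_ennreal_def simp_thms if_True)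
next
  case (finite r s)
  then have "p \<noteq> top" "p \<noteq> 1" "q \<noteq> top" by simp_all
  then show ?thesis
    by (simp only: mat_norm_l1_def lp_norm_def infinity_ennreal_def simp_thms if_False)
qed

text \<open>Turns a bound on all finite sums \<open>\<bar>\<Sum>n\<in>N. z n\<bar>\<close> into a
  bound on the l1 norm, at the cost of a factor 2.\<close>

lemma sum_abs_split_sign:
  fixes z :: "nat \<Rightarrow> real"
  obtains P Q where "finite P" "finite Q"
    and "(\<Sum>n<m. \<bar>z n\<bar>) = \<bar>\<Sum>n\<in>P. z n\<bar> + \<bar>\<Sum>n\<in>Q. z n\<bar>"
proof -
  define P where "P = {n \<in> {..<m}. 0 \<le> z n}"
  define Q where "Q = {n \<in> {..<m}. z n < 0}"
  have "{..<m} = P \<union> Q" "P \<inter> Q = {}" by (auto simp: P_def Q_def)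
  then have "(\<Sum>n<m. \<bar>z n\<bar>) = (\<Sum>n\<in>P. \<bar>z n\<bar>) + (\<Sum>n\<in>Q. \<bar>z n\<bar>)"
    by (metis finite_Un finite_lessThan sum.union_disjoint)
  also have "(\<Sum>n\<in>P. \<bar>z n\<bar>) = \<bar>\<Sum>n\<in>P. z n\<bar>"
  proof -
    have "(\<Sum>n\<in>P. \<bar>z n\<bar>) = (\<Sum>n\<in>P. z n)" by (rule sum.cong) (auto simp: P_def)
    moreover have "0 \<le> (\<Sum>n\<in>P. z n)" by (rule sum_nonneg) (auto simp: P_def)
    ultimately show ?thesis by simp
  qed
  also have "(\<Sum>n\<in>Q. \<bar>z n\<bar>) = \<bar>\<Sum>n\<in>Q. z n\<bar>"
  proof -
    have "(\<Sum>n\<in>Q. \<bar>z n\<bar>) = (\<Sum>n\<in>Q. - z n)" by (rule sum.cong) (auto simp: Q_def)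
    moreover have "(\<Sum>n\<in>Q. z n) \<le> 0" by (rule sum_nonpos) (auto simp: Q_def)
    ultimately show ?thesis by (simp add: sum_negf)
  qed
  finally show ?thesis by (intro that[of P Q]) (auto simp: P_def Q_def)
qed

section \<open>Operator norms for bounded and for summable targets\<close>

context
  fixes lam :: "nat \<Rightarrow> real" and p q :: ennreal and A :: "nat \<Rightarrow> nat \<Rightarrow> real"
  assumes lam_pos: "\<And>k. 0 < lam k" and lam_mono: "strict_mono lam"
    and p: "1 \<le> p" and pq: "1 / p + 1 / q = 1"
begin

interpretation seq_unit_ball "unit_ball p"
  rewrites "seq_unit_ball.space (unit_ball p) = lp p"
  using p by (simp_all add: seq_unit_ball_unit_ball space_unit_ball)

text \<open>By construction of the norm, \<open>E_map\<close> is an isometric bijection with inverse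
  \<open>E_inv\<close>, so the unit balls correspond.\<close>

lemma op_norm_lpF:
  "op_norm (lpF lam p) (lpF_norm lam p) nY L = (SUP y\<in>unit_ball p. nY (L (E_inv lam y)))"
proof -
  have "{x \<in> lpF lam p. lpF_norm lam p x \<le> 1} = E_inv lam ` unit_ball p"
  proof (intro equalityI subsetI)
    fix x assume "x \<in> {x \<in> lpF lam p. lpF_norm lam p x \<le> 1}"
    then have "E_map lam x \<in> unit_ball p" by (simp add: unit_ball_def lpF_norm_def)
    then show "x \<in> E_inv lam ` unit_ball p"
      using E_inv_E_map[OF lam_pos lam_mono, of x] by (metis imageI)
  next
    fix x assume "x \<in> E_inv lam ` unit_ball p"
    then show "x \<in> {x \<in> lpF lam p. lpF_norm lam p x \<le> 1}"
      using mem_space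
      by (auto simp: lpF_def lpF_norm_def E_map_E_inv[OF lam_pos lam_mono] unit_ball_def)
  qed
  then show ?thesis unfolding op_norm_def by (simp add: image_image)
qed

lemma mat_class_E_inv:
  assumes "A \<in> mat_class (lpF lam p) Y" "y \<in> lp p"
  shows "summable (\<lambda>k. A n k * E_inv lam y k)" "mat_map A (E_inv lam y) \<in> Y"
  using assms by (auto simp: mat_class_def lpF_def E_map_E_inv[OF lam_pos lam_mono])

lemma mat_class_row:
  assumes A: "A \<in> mat_class (lpF lam p) Y"
  shows "linear_functional (\<lambda>y. mat_map A (E_inv lam y) n)"
    and "\<exists>C. \<forall>y\<in>unit_ball p. \<bar>mat_map A (E_inv lam y) n\<bar> \<le> C"
    and "y \<in> lp p \<Longrightarrow> (\<lambda>k. a_hat lam A n k * y k) sums mat_map A (E_inv lam y) n"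
proof -
  have summ: "\<And>y. y \<in> lp p \<Longrightarrow> summable (\<lambda>k. A n k * E_inv lam y k)"
    by (rule mat_class_E_inv(1)[OF A])
  note * = lam_pos lam_mono p summ
  show "linear_functional (\<lambda>y. mat_map A (E_inv lam y) n)"
    by (rule linear_functional_row) (rule *; assumption)+
  show "\<exists>C. \<forall>y\<in>unit_ball p. \<bar>mat_map A (E_inv lam y) n\<bar> \<le> C"
    by (rule row_bounded) (rule *; assumption)+
  show "(\<lambda>k. a_hat lam A n k * y k) sums mat_map A (E_inv lam y) n" if "y \<in> lp p"
    by (rule row_sums[OF _ _ _ _ that]) (rule *; assumption)+
qed

text \<open>Uniform boundedness over the rows gives finiteness. For the value, exchange the suprema
  over \<open>n\<close> and \<open>y\<close> and compute each row by duality.\<close>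

lemma op_norm_linf:
  assumes A: "A \<in> mat_class (lpF lam p) (lp top)"
  shows "op_norm (lpF lam p) (lpF_norm lam p) (lp_norm top) (mat_map A) < top"
    and "op_norm (lpF lam p) (lpF_norm lam p) (lp_norm top) (mat_map A) = mat_norm_linf lam p q A"
proof -
  have "\<exists>C. \<forall>n. \<forall>y\<in>unit_ball p. \<bar>mat_map A (E_inv lam y) n\<bar> \<le> C"
  proof (rule uniform_boundedness)
    show "linear_functional (\<lambda>y. mat_map A (E_inv lam y) n)" for n
      by (rule mat_class_row(1)[OF A])
    show "\<exists>C. \<forall>y\<in>unit_ball p. \<bar>mat_map A (E_inv lam y) n\<bar> \<le> C" for n
      by (rule mat_class_row(2)[OF A])
    fix y assume "y \<in> lp p"
    then have "Bseq (mat_map A (E_inv lam y))"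
      using mat_class_E_inv(2)[OF A] lp_infinity_iff by simp
    then show "\<exists>K. \<forall>n. \<bar>mat_map A (E_inv lam y) n\<bar> \<le> K" by (auto simp: Bseq_def)
  qed
  then obtain C where C: "\<And>n y. y \<in> unit_ball p \<Longrightarrow> \<bar>mat_map A (E_inv lam y) n\<bar> \<le> C" by blast
  have "op_norm (lpF lam p) (lpF_norm lam p) (lp_norm top) (mat_map A) \<le> ennreal C"
    unfolding op_norm_lpF lp_norm_def using C by (auto intro!: SUP_least ennreal_leI)
  also have "\<dots> < top" by simp
  finally show "op_norm (lpF lam p) (lpF_norm lam p) (lp_norm top) (mat_map A) < top" .
  have "op_norm (lpF lam p) (lpF_norm lam p) (lp_norm top) (mat_map A)
      = (SUP y\<in>unit_ball p. SUP n. ennreal \<bar>mat_map A (E_inv lam y) n\<bar>)"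
    by (simp add: op_norm_lpF lp_norm_def)
  also have "\<dots> = (SUP n. SUP y\<in>unit_ball p. ennreal \<bar>mat_map A (E_inv lam y) n\<bar>)"
    by (rule SUP_commute)
  also have "\<dots> = (SUP n. lp_norm q (a_hat lam A n))"
    by (intro SUP_cong refl SUP_unit_ball_functional[OF p pq]
        mat_class_row(3)[OF A] mem_space)
  finally show "op_norm (lpF lam p) (lpF_norm lam p) (lp_norm top) (mat_map A) = mat_norm_linf lam p q A"
    by (simp add: mat_norm_linf_eq[OF p pq])
qed

context
  assumes A: "A \<in> mat_class (lpF lam p) (lp 1)"
begin

lemma l1_row_sums: "y \<in> unit_ball p \<Longrightarrow> (\<lambda>k. a_hat lam A n k * y k) sums mat_map A (E_inv lam y) n"
  by (intro mat_class_row(3)[OF A] mem_space)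

text \<open>Uniform boundedness is applied to the sums of rows over sets \<open>N\<close>, pointwise
  bounded by the l1 norm of the image; splitting by sign recovers that norm.\<close>

lemma op_norm_l1_finite: "op_norm (lpF lam p) (lpF_norm lam p) (lp_norm 1) (mat_map A) < top"
proof -
  let ?L = "\<lambda>n y. mat_map A (E_inv lam y) n"
  have lin: "linear_functional (?L n)" for n
    by (rule mat_class_row(1)[OF A])
  have "\<exists>C. \<forall>N. \<forall>y\<in>unit_ball p. \<bar>\<Sum>n\<in>N. ?L n y\<bar> \<le> C"
  proof (rule uniform_boundedness)
    \<comment> \<open>The family is indexed by a whole type, hence by all sets; over an infinite
      \<open>N\<close> the sum is 0 by convention and the bounds persist.\<close>
    fix N :: "nat set"
    show "linear_functional (\<lambda>y. \<Sum>n\<in>N. ?L n y)"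
      using lin by (simp add: linear_functional_def sum.distrib sum_distrib_left)
    have "\<forall>n. \<exists>C. \<forall>y\<in>unit_ball p. \<bar>?L n y\<bar> \<le> C"
      using mat_class_row(2)[OF A] by blast
    then obtain C where "\<And>n y. y \<in> unit_ball p \<Longrightarrow> \<bar>?L n y\<bar> \<le> C n" by metis
    then have "\<bar>\<Sum>n\<in>N. ?L n y\<bar> \<le> (\<Sum>n\<in>N. C n)" if "y \<in> unit_ball p" for y
      using that by (intro order_trans[OF sum_abs] sum_mono) auto
    then show "\<exists>C. \<forall>y\<in>unit_ball p. \<bar>\<Sum>n\<in>N. ?L n y\<bar> \<le> C" by blast
  next
    fix y assume "y \<in> lp p"
    then have sm: "summable (\<lambda>n. \<bar>?L n y\<bar>)"
      using mat_class_E_inv(2)[OF A] lp_finite_iff[of 1] by simp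
    have "\<bar>\<Sum>n\<in>N. ?L n y\<bar> \<le> (\<Sum>n. \<bar>?L n y\<bar>)" for N
    proof (cases "finite N")
      case True
      then show ?thesis
        by (intro order_trans[OF sum_abs] sum_le_suminf sm) auto
    next
      case False
      then show ?thesis using sm by (simp add: suminf_nonneg)
    qed
    then show "\<exists>K. \<forall>N. \<bar>\<Sum>n\<in>N. ?L n y\<bar> \<le> K" by blast
  qed
  then obtain C where C: "\<And>N y. y \<in> unit_ball p \<Longrightarrow> \<bar>\<Sum>n\<in>N. ?L n y\<bar> \<le> C" by blast
  have C0: "0 \<le> C" using C[OF zero_mem, of "{}"] by simp
  have "lp_norm 1 (mat_map A (E_inv lam y)) \<le> ennreal (2 * C)" if y: "y \<in> unit_ball p" for y
  proof -
    have "(\<Sum>n<m. \<bar>?L n y\<bar>) \<le> 2 * C" for m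
    proof -
      obtain P Q where "(\<Sum>n<m. \<bar>?L n y\<bar>) = \<bar>\<Sum>n\<in>P. ?L n y\<bar> + \<bar>\<Sum>n\<in>Q. ?L n y\<bar>"
        by (rule sum_abs_split_sign)
      then show ?thesis using C[OF y, of P] C[OF y, of Q] by simp
    qed
    then show ?thesis unfolding lp_norm_one using C0 by (subst suminf_ennreal_le_iff) auto
  qed
  then have "op_norm (lpF lam p) (lpF_norm lam p) (lp_norm 1) (mat_map A) \<le> ennreal (2 * C)"
    unfolding op_norm_lpF by (rule SUP_least)
  also have "\<dots> < top" by simp
  finally show ?thesis .
qed

text \<open>The unit vector at \<open>k\<close> is mapped to column \<open>k\<close> of
  \<open>a_hat\<close>, which gives the lower bound. For the upper one, finite sections allow the
  sums over rows and columns to be swapped before passing to the limit.\<close>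

lemma op_norm_l1_eq:
  assumes p1: "p = 1"
  shows "op_norm (lpF lam p) (lpF_norm lam p) (lp_norm 1) (mat_map A) = mat_norm_l1 lam p q A"
proof -
  let ?L = "\<lambda>n y. mat_map A (E_inv lam y) n" and ?a = "a_hat lam A"
  have norm: "mat_norm_l1 lam p q A = (SUP k. \<Sum>n. ennreal \<bar>?a n k\<bar>)"
  proof -
    have "p \<noteq> top" using p1 by simp
    with p1 show ?thesis by (simp only: mat_norm_l1_def infinity_ennreal_def simp_thms if_True if_False)
  qed
  show ?thesis
    unfolding op_norm_lpF norm
  proof (rule antisym)
    show "(SUP y\<in>unit_ball p. lp_norm 1 (mat_map A (E_inv lam y))) \<le> (SUP k. \<Sum>n. ennreal \<bar>?a n k\<bar>)"
    proof (rule SUP_least)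
      fix y assume y: "y \<in> unit_ball p"
      show "lp_norm 1 (mat_map A (E_inv lam y)) \<le> (SUP k. \<Sum>n. ennreal \<bar>?a n k\<bar>)"
      proof (cases "SUP k. \<Sum>n. ennreal \<bar>?a n k\<bar>")
        case (real M)
        have col: "(\<Sum>n<m. \<bar>?a n k\<bar>) \<le> M" for m k
        proof -
          have "(\<Sum>n. ennreal \<bar>?a n k\<bar>) \<le> ennreal M"
            unfolding real(2)[symmetric] by (rule SUP_upper) simp
          then show ?thesis using real(1) by (subst (asm) suminf_ennreal_le_iff) auto
        qed
        have "(\<Sum>n<m. \<bar>?L n y\<bar>) \<le> M" for m
        proof (rule LIMSEQ_le_const2)
          show "(\<lambda>i. \<Sum>n<m. \<bar>\<Sum>k<i. ?a n k * y k\<bar>) \<longlonglongrightarrow> (\<Sum>n<m. \<bar>?L n y\<bar>)"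
            using l1_row_sums[OF y] unfolding sums_def by (intro tendsto_sum tendsto_rabs)
          have "(\<Sum>n<m. \<bar>\<Sum>k<i. ?a n k * y k\<bar>) \<le> M" for i
          proof -
            have "(\<Sum>n<m. \<bar>\<Sum>k<i. ?a n k * y k\<bar>) \<le> (\<Sum>n<m. \<Sum>k<i. \<bar>?a n k * y k\<bar>)"
              by (intro sum_mono sum_abs)
            also have "\<dots> = (\<Sum>k<i. (\<Sum>n<m. \<bar>?a n k\<bar>) * \<bar>y k\<bar>)"
              by (subst sum.swap) (simp add: abs_mult sum_distrib_right)
            also have "\<dots> \<le> (\<Sum>k<i. M * \<bar>y k\<bar>)"
              using col by (intro sum_mono mult_right_mono) auto
            also have "\<dots> = M * (\<Sum>k<i. \<bar>y k\<bar>)" by (simp add: sum_distrib_left)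
            also have "\<dots> \<le> M * 1"
              using y p1 real(1) unit_ball_ennreal_iff[of 1 y] by (intro mult_left_mono) auto
            finally show ?thesis by simp
          qed
          then show "\<exists>i0. \<forall>i\<ge>i0. (\<Sum>n<m. \<bar>\<Sum>k<i. ?a n k * y k\<bar>) \<le> M" by blast
        qed
        then show ?thesis
          unfolding lp_norm_one real(2) using real(1) by (subst suminf_ennreal_le_iff) auto
      qed (simp only: top_greatest)
    qed
  next
    show "(SUP k. \<Sum>n. ennreal \<bar>?a n k\<bar>) \<le> (SUP y\<in>unit_ball p. lp_norm 1 (mat_map A (E_inv lam y)))"
    proof (rule SUP_least)
      fix k
      let ?e = "\<lambda>j::nat. if j = k then 1 else 0 :: real"
      have e: "?e \<in> unit_ball p" by (rule unit_vector_mem_unit_ball[OF p])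
      have "?L n ?e = ?a n k" for n
      proof -
        have "(\<lambda>j. ?a n j * ?e j) = (\<lambda>j. if j = k then ?a n j else 0)" by auto
        then have "(\<lambda>j. ?a n j * ?e j) sums ?a n k" using sums_single[of k "?a n"] by simp
        then show ?thesis using l1_row_sums[OF e] sums_unique2 by blast
      qed
      then have "(\<Sum>n. ennreal \<bar>?a n k\<bar>) = lp_norm 1 (mat_map A (E_inv lam ?e))"
        by (simp only: lp_norm_one)
      also have "\<dots> \<le> (SUP y\<in>unit_ball p. lp_norm 1 (mat_map A (E_inv lam y)))"
        using e by (rule SUP_upper)
      finally show "(\<Sum>n. ennreal \<bar>?a n k\<bar>) \<le> (SUP y\<in>unit_ball p. lp_norm 1 (mat_map A (E_inv lam y)))" .
    qed
  qed
qed

text \<open>By duality the matrix norm is the supremum of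
  \<open>\<bar>\<Sum>n\<in>N. ?L n y\<bar>\<close> over finite \<open>N\<close> and the ball. The
  triangle inequality bounds it by the operator norm, and splitting by sign gives the converse
  estimate.\<close>

lemma op_norm_l1_bounds:
  assumes p1: "p \<noteq> 1"
  shows "mat_norm_l1 lam p q A \<le> op_norm (lpF lam p) (lpF_norm lam p) (lp_norm 1) (mat_map A)"
    and "op_norm (lpF lam p) (lpF_norm lam p) (lp_norm 1) (mat_map A) \<le> 4 * mat_norm_l1 lam p q A"
proof -
  let ?L = "\<lambda>n y. mat_map A (E_inv lam y) n"
  have fin: "lp_norm q (\<lambda>k. \<Sum>n\<in>N. a_hat lam A n k) = (SUP y\<in>unit_ball p. ennreal \<bar>\<Sum>n\<in>N. ?L n y\<bar>)" for N
    using l1_row_sums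
    by (intro SUP_unit_ball_functional[OF p pq, symmetric]) (simp add: sum_distrib_right sums_sum)
  have norm: "mat_norm_l1 lam p q A
      = (SUP N\<in>{N. finite N}. SUP y\<in>unit_ball p. ennreal \<bar>\<Sum>n\<in>N. ?L n y\<bar>)"
    by (simp only: mat_norm_l1_eq[OF p pq p1] fin)
  show "mat_norm_l1 lam p q A \<le> op_norm (lpF lam p) (lpF_norm lam p) (lp_norm 1) (mat_map A)"
    unfolding norm op_norm_lpF
  proof (intro SUP_least)
    fix N y assume N: "N \<in> {N :: nat set. finite N}" and y: "y \<in> unit_ball p"
    have "ennreal \<bar>\<Sum>n\<in>N. ?L n y\<bar> \<le> ennreal (\<Sum>n\<in>N. \<bar>?L n y\<bar>)" by (intro ennreal_leI sum_abs)
    also have "\<dots> = (\<Sum>n\<in>N. ennreal \<bar>?L n y\<bar>)" by (simp add: sum_ennreal)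
    also have "\<dots> \<le> lp_norm 1 (mat_map A (E_inv lam y))"
      unfolding lp_norm_one using N by (intro sum_le_suminf) auto
    also have "\<dots> \<le> (SUP y\<in>unit_ball p. lp_norm 1 (mat_map A (E_inv lam y)))"
      using y by (rule SUP_upper)
    finally show "ennreal \<bar>\<Sum>n\<in>N. ?L n y\<bar> \<le> (SUP y\<in>unit_ball p. lp_norm 1 (mat_map A (E_inv lam y)))" .
  qed
  let ?M = "mat_norm_l1 lam p q A"
  have upper: "ennreal \<bar>\<Sum>n\<in>N. ?L n y\<bar> \<le> ?M" if "finite N" "y \<in> unit_ball p" for N y
    unfolding norm using that by (intro SUP_upper2[of N] SUP_upper2[of y]) auto
  show "op_norm (lpF lam p) (lpF_norm lam p) (lp_norm 1) (mat_map A) \<le> 4 * ?M"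
    unfolding op_norm_lpF
  proof (rule SUP_least)
    fix y assume y: "y \<in> unit_ball p"
    have "(\<Sum>n<m. ennreal \<bar>?L n y\<bar>) \<le> 4 * ?M" for m
    proof -
      obtain P Q where PQ: "finite P" "finite Q"
        and "(\<Sum>n<m. \<bar>?L n y\<bar>) = \<bar>\<Sum>n\<in>P. ?L n y\<bar> + \<bar>\<Sum>n\<in>Q. ?L n y\<bar>"
        by (rule sum_abs_split_sign)
      then have "(\<Sum>n<m. ennreal \<bar>?L n y\<bar>) = ennreal \<bar>\<Sum>n\<in>P. ?L n y\<bar> + ennreal \<bar>\<Sum>n\<in>Q. ?L n y\<bar>"
        by (simp add: sum_ennreal flip: ennreal_plus)
      also have "\<dots> \<le> ?M + ?M" using PQ y by (intro add_mono upper)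
      also have "\<dots> = 2 * ?M" by (simp add: mult_2)
      also have "\<dots> \<le> 4 * ?M" by (intro mult_right_mono) auto
      finally show ?thesis .
    qed
    then show "lp_norm 1 (mat_map A (E_inv lam y)) \<le> 4 * ?M"
      unfolding lp_norm_one suminf_eq_SUP by (intro SUP_least)
  qed
qed

end

end

theorem theorem6p15:
  fixes lam :: "nat \<Rightarrow> real" and A :: "nat \<Rightarrow> nat \<Rightarrow> real" and p q :: ennreal
  assumes lam_pos: "\<And>k. 0 < lam k"
    and lam_mono: "strict_mono lam"
    and lam_lim: "filterlim lam at_top sequentially"
    and p: "1 \<le> p"
    and pq: "1 / p + 1 / q = 1"
  shows "(\<forall>Y \<in> {c_null, c_conv, lp \<infinity>}. A \<in> mat_class (lpF lam p) Y \<longrightarrow>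
            op_norm (lpF lam p) (lpF_norm lam p) (lp_norm \<infinity>) (mat_map A) < \<infinity> \<and>
            op_norm (lpF lam p) (lpF_norm lam p) (lp_norm \<infinity>) (mat_map A)
              = mat_norm_linf lam p q A)
       \<and> (A \<in> mat_class (lpF lam p) (lp 1) \<longrightarrow>
            op_norm (lpF lam p) (lpF_norm lam p) (lp_norm 1) (mat_map A) < \<infinity> \<and>
            (p = 1 \<longrightarrow>
               op_norm (lpF lam p) (lpF_norm lam p) (lp_norm 1) (mat_map A)
                 = mat_norm_l1 lam p q A) \<and>
            (p \<noteq> 1 \<longrightarrow>
               mat_norm_l1 lam p q A
                 \<le> op_norm (lpF lam p) (lpF_norm lam p) (lp_norm 1) (mat_map A) \<and>
               op_norm (lpF lam p) (lpF_norm lam p) (lp_norm 1) (mat_map A)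
                 \<le> 4 * mat_norm_l1 lam p q A))"
proof (intro conjI ballI impI)
  fix Y assume Y: "Y \<in> {c_null, c_conv, lp \<infinity>}" and "A \<in> mat_class (lpF lam p) Y"
  \<comment> \<open>All three targets carry the sup norm and lie in \<open>lp \<infinity>\<close>,
    so one case settles them.\<close>
  moreover have "Y \<subseteq> lp \<infinity>"
    using Y lp_infinity_iff
    by (auto simp: c_null_def c_conv_def intro: convergent_imp_Bseq convergentI)
  ultimately have A: "A \<in> mat_class (lpF lam p) (lp top)" by (auto simp: mat_class_def)
  show "op_norm (lpF lam p) (lpF_norm lam p) (lp_norm \<infinity>) (mat_map A) < \<infinity>"
    using op_norm_linf(1)[OF lam_pos lam_mono p pq A] by simp
  show "op_norm (lpF lam p) (lpF_norm lam p) (lp_norm \<infinity>) (mat_map A) = mat_norm_linf lam p q A"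
    using op_norm_linf(2)[OF lam_pos lam_mono p pq A] by simp
next
  assume A: "A \<in> mat_class (lpF lam p) (lp 1)"
  show "op_norm (lpF lam p) (lpF_norm lam p) (lp_norm 1) (mat_map A) < \<infinity>"
    using op_norm_l1_finite[OF lam_pos lam_mono p pq A] by simp
  show "op_norm (lpF lam p) (lpF_norm lam p) (lp_norm 1) (mat_map A) = mat_norm_l1 lam p q A"
    if "p = 1"
    by (rule op_norm_l1_eq[OF lam_pos lam_mono p pq A that])
  show "mat_norm_l1 lam p q A \<le> op_norm (lpF lam p) (lpF_norm lam p) (lp_norm 1) (mat_map A)"
    "op_norm (lpF lam p) (lpF_norm lam p) (lp_norm 1) (mat_map A) \<le> 4 * mat_norm_l1 lam p q A"
    if "p \<noteq> 1"
    by (rule op_norm_l1_bounds[OF lam_pos lam_mono p pq A that])+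
qed

end
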